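(* Let $p,T\ge 1$ be integers, let $q\in\{0\}\cup[1,\infty)$, let $m_t\in\mathbb{R}^p$ and $\lambda_t\ge 0$ for $t=0,\dots,T$ be given. For $\gamma\in[0,1]$ consider the problem $$\min_{\theta_0,\dots,\theta_T\in\mathbb{R}^p}\ \gamma\sum_{t=0}^T\|\theta_t\|_0+(1-\gamma)\sum_{t=1}^T\|\theta_t-\theta_{t-1}\|_q^q\quad\text{s.t.}\quad \|\theta_t-m_t\|_\infty\le\lambda_t,\ t=0,\dots,T.\qquad(\mathrm{ProxGL})$$ Then the entire solution path of this problem, i.e. optimal solutions for all values $\gamma\in[0,1]$ simultaneously, can be computed in at most $\mathcal{O}(pT^3)$ time on a single thread (for each fixed $q$, the implied constant does not depend on $p$, $T$ or the data $m_t,\lambda_t$).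
   Context: $\|v\|_0$ is the number of nonzero entries of $v$; for $q\ge1$, $\|v\|_q^q=\sum_i|v_i|^q$; for $q=0$, $\|v\|_0^0$ is understood as $\|v\|_0$. In the paper $m_t=\widetilde F^*(\widehat\mu_t)$ is an approximate backward mapping evaluated at an empirical mean parameter; for this result it is just a given vector. Time is the number of elementary operations on real numbers (arithmetic operations, comparisons, and evaluations of $x\mapsto|x|^q$, each at unit cost). Computing the solution path means computing, for each coordinate $i\in\{1,\dots,p\}$, a finite list of feasible sequences $(\theta_{0;i},\dots,\theta_{T;i})$ such that for every $\gamma\in[0,1]$, choosing for each coordinate a sequence in its list with the smallest value of that coordinate's part of the objective gives an optimal solution of (ProxGL) for that $\gamma$. *)

theory Defs
  imports "HOL-Analysis.Analysis"
begin

section \<open>The problem (ProxGL)\<close>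

text \<open>
  A vector \<open>v\<close> in \<open>R^p\<close> is a function \<open>nat \<Rightarrow> real\<close> of which only the entries \<open>1, \<dots>, p\<close> are
  ever inspected. The entry \<open>i\<close> of the vector with time index \<open>t\<close> is written \<open>m t i\<close>
  or \<open>\<theta> t i\<close>.
\<close>

definition norm_0 :: "nat \<Rightarrow> (nat \<Rightarrow> real) \<Rightarrow> nat" where
  "norm_0 p v = card {i \<in> {1..p}. v i \<noteq> 0}"

text \<open>The \<open>q\<close>-th power of the \<open>q\<close>-norm, and the number of nonzero entries for \<open>q = 0\<close>.\<close>

definition norm_pow :: "real \<Rightarrow> nat \<Rightarrow> (nat \<Rightarrow> real) \<Rightarrow> real" where
  "norm_pow q p v =
     (if q = 0 then real (norm_0 p v) else (\<Sum>i=1..p. \<bar>v i\<bar> powr q))"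

text \<open>Only used for \<open>p \<ge> 1\<close>, where the maximum is over a nonempty set.\<close>

definition norm_inf :: "nat \<Rightarrow> (nat \<Rightarrow> real) \<Rightarrow> real" where
  "norm_inf p v = Max ((\<lambda>i. \<bar>v i\<bar>) ` {1..p})"

definition feasible ::
  "nat \<Rightarrow> nat \<Rightarrow> (nat \<Rightarrow> nat \<Rightarrow> real) \<Rightarrow> (nat \<Rightarrow> real) \<Rightarrow> (nat \<Rightarrow> nat \<Rightarrow> real) \<Rightarrow> bool" where
  "feasible p T m lam \<theta> \<longleftrightarrow> (\<forall>t\<le>T. norm_inf p (\<lambda>i. \<theta> t i - m t i) \<le> lam t)"

definition objective ::
  "real \<Rightarrow> nat \<Rightarrow> nat \<Rightarrow> real \<Rightarrow> (nat \<Rightarrow> nat \<Rightarrow> real) \<Rightarrow> real" where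
  "objective q p T \<gamma> \<theta> =
     \<gamma> * (\<Sum>t=0..T. real (norm_0 p (\<theta> t))) +
     (1 - \<gamma>) * (\<Sum>t=1..T. norm_pow q p (\<lambda>i. \<theta> t i - \<theta> (t - 1) i))"

definition optimal ::
  "real \<Rightarrow> nat \<Rightarrow> nat \<Rightarrow> (nat \<Rightarrow> nat \<Rightarrow> real) \<Rightarrow> (nat \<Rightarrow> real) \<Rightarrow> real \<Rightarrow> (nat \<Rightarrow> nat \<Rightarrow> real) \<Rightarrow> bool"
where
  "optimal q p T m lam \<gamma> \<theta> \<longleftrightarrow>
     feasible p T m lam \<theta> \<and>
     (\<forall>\<theta>'. feasible p T m lam \<theta>' \<longrightarrow> objective q p T \<gamma> \<theta> \<le> objective q p T \<gamma> \<theta>')"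


section \<open>Solution paths\<close>

text \<open>The function \<open>x \<mapsto> |x|^q\<close>, with the convention \<open>|0|^0 = 0\<close>.\<close>

definition abs_pow :: "real \<Rightarrow> real \<Rightarrow> real" where
  "abs_pow q x = (if q = 0 then of_bool (x \<noteq> 0) else \<bar>x\<bar> powr q)"

text \<open>The contribution of a single coordinate, whose sequence of values is \<open>x 0, \<dots>, x T\<close>.\<close>

definition coord_objective :: "real \<Rightarrow> nat \<Rightarrow> real \<Rightarrow> (nat \<Rightarrow> real) \<Rightarrow> real" where
  "coord_objective q T \<gamma> x =
     \<gamma> * real (card {t \<in> {0..T}. x t \<noteq> 0}) +
     (1 - \<gamma>) * (\<Sum>t=1..T. abs_pow q (x t - x (t - 1)))"

text \<open>
  \<open>L i\<close> is the list of candidate sequences of coordinate \<open>i\<close>. It must not be empty: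
  otherwise no choice of minimizers would exist and the last condition would be void.
\<close>

definition solution_path ::
  "real \<Rightarrow> nat \<Rightarrow> nat \<Rightarrow> (nat \<Rightarrow> nat \<Rightarrow> real) \<Rightarrow> (nat \<Rightarrow> real) \<Rightarrow> (nat \<Rightarrow> (nat \<Rightarrow> real) list) \<Rightarrow> bool"
where
  "solution_path q p T m lam L \<longleftrightarrow>
     (\<forall>i\<in>{1..p}. L i \<noteq> [] \<and> (\<forall>x\<in>set (L i). \<forall>t\<le>T. \<bar>x t - m t i\<bar> \<le> lam t)) \<and>
     (\<forall>\<gamma>\<in>{0..1}. \<forall>x.
        (\<forall>i\<in>{1..p}. x i \<in> set (L i) \<and>
           (\<forall>y\<in>set (L i). coord_objective q T \<gamma> (x i) \<le> coord_objective q T \<gamma> y)) \<longrightarrow>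
        optimal q p T m lam \<gamma> (\<lambda>t i. x i t))"


section \<open>A sequential real random access machine\<close>

text \<open>
  The store has two sorts of cells, holding natural numbers (for indices and counters) and
  real numbers. A cell is addressed by an array name and a list of indices, scalars having
  the empty list; the number of indices of each access is fixed by the program text.
  No operation turns a real number into a natural number; reals influence the control flow
  only through comparisons.
\<close>

type_synonym cell = "string \<times> nat list"

record store =
  nats :: "cell \<Rightarrow> nat"
  reals :: "cell \<Rightarrow> real"

datatype nexp =
    NConst nat
  | NCell string "nexp list"
  | NAdd nexp nexp
  | NSub nexp nexp

datatype rexp =
    RConst int
  | RCell string "nexp list"
  | RAdd rexp rexp
  | RSub rexp rexp
  | RMul rexp rexp
  | RDiv rexp rexp
  | RAbsPow rexp

datatype test =
    NLess nexp nexp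
  | RLess rexp rexp
  | TNot test
  | TAnd test test

datatype com =
    Skip
  | NAssign string "nexp list" nexp
  | RAssign string "nexp list" rexp
  | Sequ com com
  | Cond test com com
  | While test com

text \<open>Subtraction of natural numbers is truncated, and division by zero yields zero.\<close>

primrec nval :: "store \<Rightarrow> nexp \<Rightarrow> nat" where
  "nval s (NConst k) = k"
| "nval s (NCell a is) = nats s (a, map (nval s) is)"
| "nval s (NAdd e f) = nval s e + nval s f"
| "nval s (NSub e f) = nval s e - nval s f"

primrec rval :: "real \<Rightarrow> store \<Rightarrow> rexp \<Rightarrow> real" where
  "rval q s (RConst k) = of_int k"
| "rval q s (RCell a is) = reals s (a, map (nval s) is)"
| "rval q s (RAdd e f) = rval q s e + rval q s f"
| "rval q s (RSub e f) = rval q s e - rval q s f"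
| "rval q s (RMul e f) = rval q s e * rval q s f"
| "rval q s (RDiv e f) = rval q s e / rval q s f"
| "rval q s (RAbsPow e) = abs_pow q (rval q s e)"

primrec tval :: "real \<Rightarrow> store \<Rightarrow> test \<Rightarrow> bool" where
  "tval q s (NLess e f) \<longleftrightarrow> nval s e < nval s f"
| "tval q s (RLess e f) \<longleftrightarrow> rval q s e < rval q s f"
| "tval q s (TNot b) \<longleftrightarrow> \<not> tval q s b"
| "tval q s (TAnd b c) \<longleftrightarrow> tval q s b \<and> tval q s c"

text \<open>
  Every arithmetic operation, comparison and evaluation of \<open>x \<mapsto> |x|^q\<close> on reals costs one
  unit. So does every constant, memory access, index operation, Boolean connective and
  assignment; hence the running time bounds the number of operations on real numbers from
  above, and neither control flow nor writing the output is free.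
\<close>

primrec ncost :: "nexp \<Rightarrow> nat" where
  "ncost (NConst k) = 1"
| "ncost (NCell a is) = 1 + sum_list (map ncost is)"
| "ncost (NAdd e f) = 1 + ncost e + ncost f"
| "ncost (NSub e f) = 1 + ncost e + ncost f"

primrec rcost :: "rexp \<Rightarrow> nat" where
  "rcost (RConst k) = 1"
| "rcost (RCell a is) = 1 + sum_list (map ncost is)"
| "rcost (RAdd e f) = 1 + rcost e + rcost f"
| "rcost (RSub e f) = 1 + rcost e + rcost f"
| "rcost (RMul e f) = 1 + rcost e + rcost f"
| "rcost (RDiv e f) = 1 + rcost e + rcost f"
| "rcost (RAbsPow e) = 1 + rcost e"

primrec tcost :: "test \<Rightarrow> nat" where
  "tcost (NLess e f) = 1 + ncost e + ncost f"
| "tcost (RLess e f) = 1 + rcost e + rcost f"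
| "tcost (TNot b) = 1 + tcost b"
| "tcost (TAnd b c) = 1 + tcost b + tcost c"

text \<open>\<open>exec q c s n s'\<close>: started in store \<open>s\<close>, \<open>c\<close> terminates in store \<open>s'\<close> after time \<open>n\<close>.\<close>

inductive exec :: "real \<Rightarrow> com \<Rightarrow> store \<Rightarrow> nat \<Rightarrow> store \<Rightarrow> bool" for q where
  Skip: "exec q Skip s 1 s"
| NAssign: "exec q (NAssign a is e) s (1 + sum_list (map ncost is) + ncost e)
     (s\<lparr>nats := (nats s)((a, map (nval s) is) := nval s e)\<rparr>)"
| RAssign: "exec q (RAssign a is e) s (1 + sum_list (map ncost is) + rcost e)
     (s\<lparr>reals := (reals s)((a, map (nval s) is) := rval q s e)\<rparr>)"
| Sequ: "exec q c s n s' \<Longrightarrow> exec q d s' k s'' \<Longrightarrow> exec q (Sequ c d) s (n + k) s''"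
| CondTrue: "tval q s b \<Longrightarrow> exec q c s n s' \<Longrightarrow> exec q (Cond b c d) s (tcost b + n) s'"
| CondFalse: "\<not> tval q s b \<Longrightarrow> exec q d s n s' \<Longrightarrow> exec q (Cond b c d) s (tcost b + n) s'"
| WhileFalse: "\<not> tval q s b \<Longrightarrow> exec q (While b c) s (tcost b) s"
| WhileTrue: "tval q s b \<Longrightarrow> exec q c s n s' \<Longrightarrow> exec q (While b c) s' k s'' \<Longrightarrow>
     exec q (While b c) s (tcost b + n + k) s''"

text \<open>
  Initially the scalars \<open>p\<close> and \<open>T\<close> and the arrays \<open>m[t,i]\<close> and \<open>lambda[t]\<close> contain the
  data of the problem, and all other cells are zero.
\<close>

definition input_store :: "nat \<Rightarrow> nat \<Rightarrow> (nat \<Rightarrow> nat \<Rightarrow> real) \<Rightarrow> (nat \<Rightarrow> real) \<Rightarrow> store" where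
  "input_store p T m lam =
     \<lparr>nats = (\<lambda>_. 0)((''p'', []) := p, (''T'', []) := T),
      reals = (\<lambda>(a, is).
        if a = ''m'' \<and> (\<exists>t\<in>{0..T}. \<exists>i\<in>{1..p}. is = [t, i]) then m (is ! 0) (is ! 1)
        else if a = ''lambda'' \<and> (\<exists>t\<in>{0..T}. is = [t]) then lam (is ! 0)
        else 0)\<rparr>"

text \<open>
  In the end, \<open>count[i]\<close> is the number of sequences in the list of coordinate \<open>i\<close>, and
  \<open>theta[i,k,t]\<close> is the entry with time index \<open>t\<close> of the \<open>k\<close>-th of them, counting from 0.
\<close>

definition computed_path :: "store \<Rightarrow> nat \<Rightarrow> (nat \<Rightarrow> real) list" where
  "computed_path s i =
     map (\<lambda>k t. reals s (''theta'', [i, k, t])) [0..<nats s (''count'', [i])]"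

end

theory Submission
  imports Defs
begin

text \<open>
  The objective is a sum over the coordinates, so it suffices to treat one of them. Let
  \<open>n = T + 1\<close> and number the times from 1 to \<open>n\<close>. The feasible sequences are those in a tube
  \<open>a r \<le> x r \<le> b r\<close>, and only two numbers of a sequence matter: the size of its
  support and its variation, the sum of the \<open>|x r - x (r - 1)|^q\<close>. If every sequence in the
  tube is dominated in both numbers by a listed one, then the list contains an optimal
  sequence for every \<open>\<gamma>\<close>. It is enough to list, for each \<open>k \<le> n\<close>, a sequence of
  least variation among those with at most \<open>k\<close> nonzero entries.

  These sequences are shortest paths in a graph. Call a time \<open>r\<close> a knot of \<open>x\<close> if \<open>x r\<close> is
  \<open>0\<close>, \<open>a r\<close> or \<open>b r\<close>. Between consecutive knots \<open>x\<close> may be assumed to have a canonical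
  form. For \<open>q \<ge> 1\<close> this is the straight line: moving \<open>x\<close> linearly towards it does not
  increase the variation, and the motion either arrives or is stopped by a barrier and
  creates a further knot. For \<open>q = 0\<close> it is a sequence with at most one jump: a constant
  block between two jumps can be moved until it touches a barrier and creates a further
  knot. In both cases the entries between the knots were nonzero, so the support does not
  grow. Induction on the distance of the knots (\<open>walk_segment\<close>) shows that each sequence is
  dominated by a walk through a graph on the \<open>3 n\<close> possible knots, a source and a sink
  (\<open>ex_walk\<close>).

  An edge of this graph is checked and priced by running through its entries, which takes
  \<open>O(n)\<close> for each of \<open>O(n^2)\<close> edges. The dynamic program over pairs of a node and a bound on
  the support has \<open>O(n^2)\<close> entries with \<open>O(n)\<close> possible predecessors each. Copying the whole
  sequence into every entry costs \<open>O(n)\<close> again, and makes it unnecessary to trace paths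
  back. Altogether the time is \<open>O(n^3)\<close> for each coordinate.

  The program is verified in a weakest precondition calculus with time budgets, where
  \<open>runs q c s B Q\<close> says that \<open>c\<close> leads from \<open>s\<close> to a store with \<open>Q\<close> in time at most \<open>B\<close>; the
  numerical factors in the time bounds are generous roundings. The table entries are treated
  by \<open>cell_com_correct\<close>, one coordinate by \<open>coord_com_correct\<close>, and the passage to all
  coordinates by \<open>solution_path_if_coords_ok\<close>.
\<close>

section \<open>Convexity and motion towards a target\<close>

lemma convex_on_abs_pow:
  assumes "1 \<le> q"
  shows "convex_on UNIV (abs_pow q)"
proof (rule convex_onI)
  fix t x y :: real
  assume t: "0 < t" "t < 1"
  have nonneg: "((1 - t) * u + t * v) powr q \<le> (1 - t) * u powr q + t * v powr q"
    if uv: "0 \<le> u" "0 \<le> v" for u v :: real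
  proof -
    have small: "(c * w) powr q \<le> c * w powr q" if "0 < c" "c < 1" "0 \<le> w" for c w :: real
    proof -
      have "c powr q \<le> c powr 1"
        using that assms by (intro powr_mono') auto
      then show ?thesis
        using that by (simp add: powr_mult mult_right_mono)
    qed
    consider "u = 0" | "v = 0" | "0 < u" "0 < v"
      using uv by (metis less_eq_real_def)
    then show ?thesis
    proof cases
      case 3
      then show ?thesis
        using convex_onD[OF powr_convex[OF assms], of t u v] t by simp
    qed (use t uv small[of t v] small[of "1 - t" u] assms in auto)
  qed
  have "\<bar>(1 - t) * x + t * y\<bar> \<le> (1 - t) * \<bar>x\<bar> + t * \<bar>y\<bar>"
    using t abs_triangle_ineq[of "(1 - t) * x" "t * y"] by (simp add: abs_mult)
  then have "\<bar>(1 - t) * x + t * y\<bar> powr q \<le> ((1 - t) * \<bar>x\<bar> + t * \<bar>y\<bar>) powr q"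
    using assms by (intro powr_mono2) auto
  also have "\<dots> \<le> (1 - t) * \<bar>x\<bar> powr q + t * \<bar>y\<bar> powr q"
    by (rule nonneg) auto
  finally show "abs_pow q ((1 - t) *\<^sub>R x + t *\<^sub>R y) \<le> (1 - t) * abs_pow q x + t * abs_pow q y"
    using assms by (simp add: abs_pow_def)
qed simp

lemma abs_pow_0 [simp]: "abs_pow q 0 = 0"
  by (simp add: abs_pow_def)

lemma abs_pow_nonneg [simp]: "0 \<le> abs_pow q x"
  by (simp add: abs_pow_def)

text \<open>
  A point that moves inside a finite product of intervals on a straight line towards \<open>g\<close>
  either arrives there or can be stopped on the boundary. Stopping it when the first
  coordinate meets its barrier keeps all the others inside, because they are there at the
  start and intervals are convex.
\<close>

lemma homotopy_touches:
  fixes a b x g :: "nat \<Rightarrow> real"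
  assumes "finite J" and "\<And>r. r \<in> J \<Longrightarrow> a r \<le> x r \<and> x r \<le> b r"
  shows "\<exists>l\<in>{0..1}. (\<forall>r\<in>J. a r \<le> x r + l * (g r - x r) \<and> x r + l * (g r - x r) \<le> b r) \<and>
    (l = 1 \<or> (\<exists>r\<in>J. x r + l * (g r - x r) \<in> {a r, b r}))"
  using assms
proof (induction J rule: finite_induct)
  case empty
  then show ?case by (intro bexI[of _ 1]) auto
next
  case (insert j J)
  define y where "y l r = x r + l * (g r - x r)" for l r
  obtain l where l: "0 \<le> l" "l \<le> 1" "\<forall>r\<in>J. a r \<le> y l r \<and> y l r \<le> b r"
    "l = 1 \<or> (\<exists>r\<in>J. y l r \<in> {a r, b r})"
    using insert.IH insert.prems unfolding y_def by (metis atLeastAtMost_iff insertI2)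
  have x: "a j \<le> x j" "x j \<le> b j"
    using insert.prems by auto
  show ?case
  proof (cases "a j \<le> y l j \<and> y l j \<le> b j")
    case True
    then show ?thesis
      using l by (intro bexI[of _ l]) (auto simp: y_def)
  next
    case False
    \<comment> \<open>The point \<open>j\<close> leaves its interval before time \<open>l\<close>; stop when it crosses the barrier.\<close>
    have between: "a r \<le> y l' r \<and> y l' r \<le> b r" if "r \<in> J" "0 \<le> l'" "l' \<le> l" for r l'
    proof -
      have "y l' r \<in> closed_segment (y 0 r) (y l r)"
      proof (cases "l = 0")
        case False
        have "y l' r = (1 - l'/l) *\<^sub>R y 0 r + (l'/l) *\<^sub>R y l r"
          using False by (simp add: y_def algebra_simps)
        then show ?thesis
          using that by (auto simp: closed_segment_def intro!: exI[of _ "l'/l"] simp: divide_le_eq_1)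
      qed (use that in auto)
      moreover have "a r \<le> y 0 r" "y 0 r \<le> b r"
        using insert.prems that by (auto simp: y_def)
      ultimately show ?thesis
        using l(3) that(1) by (auto simp: closed_segment_eq_real_ivl split: if_splits)
    qed
    have "\<exists>l'. 0 \<le> l' \<and> l' \<le> l \<and> y l' j \<in> {a j, b j}"
    proof (cases "y l j < a j")
      case True
      then have "\<exists>l'\<ge>0. l' \<le> l \<and> y l' j = a j"
        using x l(1) unfolding y_def by (intro IVT2) (auto intro!: continuous_intros)
      then show ?thesis by auto
    next
      case not_less: False
      then have "\<exists>l'\<ge>0. l' \<le> l \<and> y l' j = b j"
        using x l(1) False unfolding y_def by (intro IVT) (auto intro!: continuous_intros)
      then show ?thesis by auto
    qed
    then obtain l' where l': "0 \<le> l'" "l' \<le> l" "y l' j \<in> {a j, b j}" by blast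
    then have "a j \<le> y l' j \<and> y l' j \<le> b j"
      using x by auto
    then show ?thesis
      using l' l(2) between by (intro bexI[of _ l']) (auto simp: y_def)
  qed
qed

section \<open>The graph of a tube\<close>

text \<open>
  The nodes are numbered so that index arithmetic recovers them: node 0 is a source before
  time 1, and the nodes \<open>3 r - 2\<close>, \<open>3 r - 1\<close>, \<open>3 r\<close> are the possible knots \<open>0\<close>, \<open>a r\<close>, \<open>b r\<close>
  at time \<open>r\<close>. The formula for \<open>tau\<close> also gives the sink \<open>3 n + 1\<close> the time \<open>n + 1\<close>.
\<close>

definition tau :: "nat \<Rightarrow> nat" where
  "tau u = (u + 2) div 3"

definition node_val :: "(nat \<Rightarrow> real) \<Rightarrow> (nat \<Rightarrow> real) \<Rightarrow> nat \<Rightarrow> real" where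
  "node_val a b u = (if u mod 3 = 1 then 0 else if u mod 3 = 2 then a (tau u) else b (tau u))"

lemma tau_0 [simp]: "tau 0 = 0"
  by (simp add: tau_def)

lemma tau_eq_0_iff [simp]: "tau u = 0 \<longleftrightarrow> u = 0"
  by (auto simp: tau_def)

lemma tau_mono: "u \<le> v \<Longrightarrow> tau u \<le> tau v"
  by (auto simp: tau_def div_le_mono)

lemma tau_less_imp_less: "tau u < tau v \<Longrightarrow> u < v"
  using tau_mono[of v u] by linarith

lemma ex_node_iff:
  assumes "1 \<le> t"
  shows "(\<exists>u. tau u = t \<and> node_val a b u = y) \<longleftrightarrow> y \<in> {0, a t, b t}"
proof
  assume y: "y \<in> {0, a t, b t}"
  obtain t' where t': "t = Suc t'"
    using assms by (cases t) auto
  have tau: "tau (3 * t' + 1) = t" "tau (3 * t' + 2) = t" "tau (3 * t' + 3) = t"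
    using t' by (simp_all add: tau_def)
  have "(3 * t' + 1) mod 3 = 1" "(3 * t' + 2) mod 3 = 2" "(3 * t' + 3) mod 3 = 0"
    by presburger+
  then have "node_val a b (3 * t' + 1) = 0" "node_val a b (3 * t' + 2) = a t"
    "node_val a b (3 * t' + 3) = b t"
    using tau by (simp_all add: node_val_def)
  then show "\<exists>u. tau u = t \<and> node_val a b u = y"
    using y tau by (metis insertE singletonD)
qed (auto simp: node_val_def)

locale tube =
  fixes q :: real and n :: nat and a b :: "nat \<Rightarrow> real"
  assumes q: "q = 0 \<or> 1 \<le> q" and n: "1 \<le> n"
begin

abbreviation "sink \<equiv> 3 * n + 1"

abbreviation "val \<equiv> node_val a b"

definition in_tube :: "(nat \<Rightarrow> real) \<Rightarrow> bool" where
  "in_tube x \<longleftrightarrow> (\<forall>r\<in>{1..n}. a r \<le> x r \<and> x r \<le> b r)"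

definition var :: "(nat \<Rightarrow> real) \<Rightarrow> nat \<Rightarrow> nat \<Rightarrow> real" where
  "var x s e = (\<Sum>r\<in>{s<..e}. abs_pow q (x r - x (r - 1)))"

definition supp :: "(nat \<Rightarrow> real) \<Rightarrow> nat \<Rightarrow> nat \<Rightarrow> nat" where
  "supp x s e = card {r \<in> {s<..e}. x r \<noteq> 0}"

text \<open>
  The sink has no entry of its own, so an edge into it ends with the last entry of the
  sequence.
\<close>

definition end_time :: "nat \<Rightarrow> nat" where
  "end_time v = min (tau v) n"

text \<open>
  An edge that leaves the source starts with the value of its target, and an edge that
  enters the sink ends with the value of its origin. This makes the sequence constant before
  its first and after its last knot, where any variation would be wasted.
\<close>

definition first_val :: "nat \<Rightarrow> nat \<Rightarrow> real" where
  "first_val u v = (if 0 < u then val u else val v)"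

definition last_val :: "nat \<Rightarrow> nat \<Rightarrow> real" where
  "last_val u v = (if v < sink then val v else first_val u v)"

text \<open>
  The entries that an edge proposes between its two knots: for \<open>q \<ge> 1\<close> the straight
  line, for \<open>q = 0\<close> a single jump, made as late as possible. The recursion mirrors the
  evaluation from left to right by the program, which knows only the previous entry. After
  the jump the entry may leave the tube; then the edge is rejected by \<open>edge\<close>.
\<close>

primrec fill :: "nat \<Rightarrow> nat \<Rightarrow> nat \<Rightarrow> real" where
  "fill u v 0 = first_val u v"
| "fill u v (Suc r) =
    (if Suc r \<le> tau u then first_val u v
     else if 1 \<le> q then first_val u v +
       (real (Suc r) - real (tau u)) * (last_val u v - first_val u v) / (real (tau v) - real (tau u))
     else if a (Suc r) \<le> fill u v r \<and> fill u v r \<le> b (Suc r) \<and> Suc r < tau v then fill u v r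
     else last_val u v)"

definition edge :: "nat \<Rightarrow> nat \<Rightarrow> bool" where
  "edge u v \<longleftrightarrow> tau u < tau v \<and>
     (\<forall>r\<in>{tau u<..end_time v}. a r \<le> fill u v r \<and> fill u v r \<le> b r)"

abbreviation "edge_var u v \<equiv> var (fill u v) (tau u) (end_time v)"

abbreviation "edge_supp u v \<equiv> supp (fill u v) (tau u) (end_time v)"

text \<open>
  \<open>walk v k c\<close>: some path of edges from the source to \<open>v\<close> has variation \<open>c\<close> and at most \<open>k\<close>
  nonzero entries. The arbitrary \<open>k\<close> at the source turns the exact count into an upper
  bound.
\<close>

inductive walk :: "nat \<Rightarrow> nat \<Rightarrow> real \<Rightarrow> bool" where
  start: "walk 0 k 0"
| step: "walk u k c \<Longrightarrow> edge u v \<Longrightarrow> v \<le> sink \<Longrightarrow>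
     walk v (k + edge_supp u v) (c + edge_var u v)"

lemma walk_mono: "walk u k c \<Longrightarrow> k \<le> k' \<Longrightarrow> walk u k' c"
proof (induction arbitrary: k' rule: walk.induct)
  case (step u k c v)
  then obtain j where "k' = j + edge_supp u v" "k \<le> j"
    by (metis add_le_imp_le_diff le_add_diff_inverse2 le_add2 le_trans)
  then show ?case
    using step by (auto intro: walk.step)
qed (rule walk.start)

lemma var_split: "s \<le> m \<Longrightarrow> m \<le> e \<Longrightarrow> var x s e = var x s m + var x m e"
  unfolding var_def by (subst sum.union_disjoint[symmetric]) (auto intro!: sum.cong)

lemma supp_split: "s \<le> m \<Longrightarrow> m \<le> e \<Longrightarrow> supp x s e = supp x s m + supp x m e"
  unfolding supp_def by (subst card_Un_disjoint[symmetric]) (auto intro!: arg_cong[of _ _ card])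

lemma var_nonneg: "0 \<le> var x s e"
  by (simp add: var_def sum_nonneg)

lemma var_cong: "(\<And>r. s \<le> r \<Longrightarrow> r \<le> e \<Longrightarrow> x r = y r) \<Longrightarrow> var x s e = var y s e"
  unfolding var_def by (intro sum.cong) auto

lemma fill_before: "r \<le> tau u \<Longrightarrow> fill u v r = first_val u v"
  by (cases r) auto

lemma fill_line:
  assumes "1 \<le> q" "tau u \<le> r"
  shows "fill u v r = first_val u v +
    (real r - real (tau u)) * (last_val u v - first_val u v) / (real (tau v) - real (tau u))"
proof (cases "r = tau u")
  case False
  then obtain r' where "r = Suc r'"
    using assms by (cases r) auto
  then show ?thesis
    using False assms by simp
qed (simp add: fill_before)

lemma fill_stay:
  assumes "\<not> 1 \<le> q" "tau u < r"
  shows "fill u v r =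
    (if a r \<le> fill u v (r - 1) \<and> fill u v (r - 1) \<le> b r \<and> r < tau v then fill u v (r - 1)
     else last_val u v)"
  using assms by (cases r) auto

lemma fill_const:
  assumes "first_val u v = last_val u v"
  shows "fill u v r = first_val u v"
  using assms by (induction r) auto

declare fill.simps(2) [simp del]

lemma fill_end: "tau u < tau v \<Longrightarrow> fill u v (tau v) = last_val u v"
  using fill_line[of u "tau v" v] fill_stay[of u "tau v" v] by (cases "1 \<le> q") auto

end

section \<open>Every sequence is dominated by a walk\<close>

context tube
begin

lemma tau_sink [simp]: "tau (Suc (3 * n)) = Suc n"
  by (simp add: tau_def)

lemma tau_le_n_iff: "tau v \<le> n \<longleftrightarrow> v < sink"
  by (auto simp: tau_def)

lemma max_tau_1: "u \<noteq> 0 \<Longrightarrow> max (tau u) 1 = tau u"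
  using tau_eq_0_iff[of u] by linarith

lemma in_tubeD: "in_tube x \<Longrightarrow> 1 \<le> r \<Longrightarrow> r \<le> n \<Longrightarrow> a r \<le> x r \<and> x r \<le> b r"
  by (simp add: in_tube_def)

lemma var_const: "(\<And>r. s \<le> r \<Longrightarrow> r \<le> e \<Longrightarrow> x r = c) \<Longrightarrow> var x s e = 0"
  unfolding var_def by (intro sum.neutral) auto

lemma var_Suc:
  assumes "s \<le> r"
  shows "var x s (Suc r) = var x s r + abs_pow q (x (Suc r) - x r)"
proof -
  have "{s<..Suc r} = insert (Suc r) {s<..r}"
    using assms by auto
  then show ?thesis
    by (simp add: var_def)
qed

lemma supp_Suc:
  assumes "s \<le> r"
  shows "supp x s (Suc r) = supp x s r + of_bool (x (Suc r) \<noteq> 0)"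
proof -
  have "{i \<in> {s<..Suc r}. x i \<noteq> 0} =
      (if x (Suc r) \<noteq> 0 then insert (Suc r) {i \<in> {s<..r}. x i \<noteq> 0} else {i \<in> {s<..r}. x i \<noteq> 0})"
    using assms by (auto simp: le_Suc_eq)
  then show ?thesis
    by (simp add: supp_def)
qed

lemma supp_cong: "(\<And>r. s < r \<Longrightarrow> r \<le> e \<Longrightarrow> x r = y r) \<Longrightarrow> supp x s e = supp y s e"
  unfolding supp_def by (intro arg_cong[of _ _ card]) auto

lemma var_le_var_0: "var x 1 e \<le> var x 0 e"
proof (cases "1 \<le> e")
  case True
  then show ?thesis
    using var_split[of 0 1 e x] var_nonneg[of x 0 1] by simp
qed (simp add: var_def)

lemma var_mono:
  assumes "\<And>r. s < r \<Longrightarrow> r \<le> e \<Longrightarrow> abs_pow q (y r - y (r - 1)) \<le> abs_pow q (x r - x (r - 1))"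
  shows "var y s e \<le> var x s e"
  unfolding var_def using assms by (intro sum_mono) auto

lemma var_convex:
  assumes "1 \<le> q" "0 \<le> l" "l \<le> 1"
  shows "var (\<lambda>r. x r + l * (g r - x r)) s e \<le> (1 - l) * var x s e + l * var g s e"
proof -
  have "abs_pow q (x r + l * (g r - x r) - (x (r - 1) + l * (g (r - 1) - x (r - 1))))
      \<le> (1 - l) * abs_pow q (x r - x (r - 1)) + l * abs_pow q (g r - g (r - 1))" for r
    using convex_onD[OF convex_on_abs_pow[OF assms(1)] assms(2,3), of "x r - x (r - 1)" "g r - g (r - 1)"]
    by (simp add: algebra_simps)
  then show ?thesis
    unfolding var_def sum_distrib_left sum.distrib[symmetric] by (intro sum_mono) auto
qed

text \<open>
  Jensen's inequality: among all sequences with the same ends the straight line varies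
  least.
\<close>

lemma var_ge_line:
  assumes "1 \<le> q" "s < t"
  shows "real (t - s) * abs_pow q ((x t - x s) / real (t - s)) \<le> var x s t"
proof -
  have tele: "(\<Sum>r\<in>{s<..t}. x r - x (r - 1)) = x t - x s"
    using assms(2) sum_telescope''[of s t x] by (simp add: atLeastSucAtMost_greaterThanAtMost)
  have "abs_pow q (\<Sum>r\<in>{s<..t}. (1 / real (t - s)) *\<^sub>R (x r - x (r - 1)))
      \<le> (\<Sum>r\<in>{s<..t}. (1 / real (t - s)) * abs_pow q (x r - x (r - 1)))"
    using assms by (intro convex_on_sum[OF _ _ convex_on_abs_pow]) auto
  moreover have "(\<Sum>r\<in>{s<..t}. (1 / real (t - s)) *\<^sub>R (x r - x (r - 1))) = (x t - x s) / real (t - s)"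
    by (simp only: scaleR_sum_right[symmetric] tele) simp
  moreover have "(\<Sum>r\<in>{s<..t}. (1 / real (t - s)) * abs_pow q (x r - x (r - 1))) = var x s t / real (t - s)"
    by (simp only: sum_distrib_left[symmetric] var_def) simp
  ultimately have "abs_pow q ((x t - x s) / real (t - s)) \<le> var x s t / real (t - s)"
    by simp
  then show ?thesis
    using assms(2) by (simp add: field_simps)
qed

text \<open>
  This is the step that removes a stretch between two nodes that is not in canonical form.
  Moving \<open>x\<close> linearly towards the line proposed by the edge does not increase the variation,
  by convexity and since the line is optimal. Either the motion arrives, and then the edge
  is available, or it is stopped by a barrier, and then a new knot splits the stretch.

  Between the source and the sink the line is not determined by its ends; the constant \<open>a 1\<close>
  serves as target, since it touches the barrier at time 1 and so always produces a knot.
\<close>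

lemma edge_or_improvement_convex:
  assumes q1: "1 \<le> q" and uv: "tau u < tau v" "v \<le> sink"
    and x: "in_tube x" "u \<noteq> 0 \<Longrightarrow> x (tau u) = val u" "v < sink \<Longrightarrow> x (tau v) = val v"
  shows "edge u v \<and> edge_var u v \<le> var x (max (tau u) 1) (end_time v) \<or>
    (\<exists>y. in_tube y \<and> (\<forall>r. r \<notin> {tau u<..<tau v} \<longrightarrow> y r = x r) \<and>
       (\<exists>r\<in>{tau u<..<tau v}. y r \<in> {a r, b r}) \<and>
       var y (max (tau u) 1) (end_time v) \<le> var x (max (tau u) 1) (end_time v))"
proof -
  let ?s = "max (tau u) 1" and ?e = "end_time v" and ?J = "{tau u<..<tau v}"
  have v_pos: "0 < v"
    using tau_less_imp_less[OF uv(1)] by simp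
  have tau_v: "tau v \<le> Suc n"
    using tau_mono[OF uv(2)] by simp
  have J: "1 \<le> r \<and> r \<le> n" if "r \<in> ?J" for r
    using that tau_v by auto
  define g where "g = (if u = 0 \<and> v = sink then (\<lambda>_. a 1) else fill u v)"
  have g_first: "g (tau u) = x (tau u)" if "u \<noteq> 0"
    using that x(2) by (simp add: g_def fill_before first_val_def)
  have g_last: "g (tau v) = x (tau v)" if "v < sink"
    using that x(3) uv(1) by (simp add: g_def fill_end last_val_def)
  have fill_eq: "fill u v r = first_val u v" if "u = 0 \<or> v = sink" for r
    using that by (intro fill_const) (auto simp: last_val_def first_val_def)
  have var_g: "var g ?s ?e \<le> var x ?s ?e"
  proof (cases "u = 0 \<or> v = sink")
    case True
    have "\<exists>c. \<forall>r. g r = c"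
      using fill_eq[OF True] by (auto simp: g_def)
    then have "var g ?s ?e = 0"
      using var_const by blast
    then show ?thesis
      by (simp add: var_nonneg)
  next
    case False
    then have v: "v < sink"
      using uv(2) by simp
    then have u: "u \<noteq> 0"
      using False by simp
    have s: "?s = tau u" "?e = tau v"
      using max_tau_1[OF u] v tau_le_n_iff[of v] by (simp_all add: end_time_def)
    define d where "d = (x (tau v) - x (tau u)) / real (tau v - tau u)"
    have "g r - g (r - 1) = d" if "r \<in> {tau u<..tau v}" for r
    proof -
      have eq: "g r' = x (tau u) + (real r' - real (tau u)) * d" if "tau u \<le> r'" for r'
        using that u v x uv(1) q1 less_imp_le[OF uv(1)]
        by (simp add: d_def g_def fill_line first_val_def last_val_def of_nat_diff)
      have "real (r - 1) = real r - 1"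
        using that by auto
      then show ?thesis
        using that eq[of r] eq[of "r - 1"] by (auto simp: algebra_simps)
    qed
    then have "var g ?s ?e = real (tau v - tau u) * abs_pow q d"
      unfolding var_def s by simp
    then show ?thesis
      using var_ge_line[OF q1 uv(1), of x] s by (simp add: d_def)
  qed
  obtain l where l: "0 \<le> l" "l \<le> 1"
    "\<And>r. r \<in> ?J \<Longrightarrow> a r \<le> x r + l * (g r - x r) \<and> x r + l * (g r - x r) \<le> b r"
    "l = 1 \<or> (\<exists>r\<in>?J. x r + l * (g r - x r) \<in> {a r, b r})"
    using homotopy_touches[of ?J a x b g] in_tubeD[OF x(1)] J
    by (metis atLeastAtMost_iff finite_greaterThanLessThan)
  define y where "y r = (if r \<in> ?J then x r + l * (g r - x r) else x r)" for r
  have "y r = x r + l * (g r - x r)" if "?s \<le> r" "r \<le> ?e" for r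
  proof (cases "r \<in> ?J")
    case False
    then have "r = tau u \<and> u \<noteq> 0 \<or> r = tau v \<and> v < sink"
      using that tau_le_n_iff[of v] by (cases "u = 0") (auto simp: end_time_def)
    then show ?thesis
      using False g_first g_last by (auto simp: y_def)
  qed (simp add: y_def)
  then have "var y ?s ?e = var (\<lambda>r. x r + l * (g r - x r)) ?s ?e"
    by (rule var_cong)
  also have "\<dots> \<le> (1 - l) * var x ?s ?e + l * var g ?s ?e"
    by (rule var_convex[OF q1 l(1,2)])
  also have "\<dots> \<le> (1 - l) * var x ?s ?e + l * var x ?s ?e"
    using l var_g by (intro add_left_mono mult_left_mono) auto
  finally have var_y: "var y ?s ?e \<le> var x ?s ?e"
    by (simp add: algebra_simps)
  have y_tube: "in_tube y"
    using l(3) x(1) by (auto simp: in_tube_def y_def)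
  show ?thesis
  proof (cases "\<exists>r\<in>?J. y r \<in> {a r, b r}")
    case True
    then show ?thesis
      using y_tube var_y by (intro disjI2 exI[of _ y]) (auto simp: y_def)
  next
    case False
    then have l1: "l = 1"
      using l(4) by (auto simp: y_def)
    have g: "g = fill u v"
    proof (rule ccontr)
      assume "g \<noteq> fill u v"
      then have "u = 0" "v = sink" "g 1 = a 1"
        by (auto simp: g_def split: if_splits)
      then have "1 \<in> ?J" "y 1 = a 1"
        using l1 n by (auto simp: y_def)
      then show False
        using False by blast
    qed
    have "a r \<le> fill u v r \<and> fill u v r \<le> b r" if "tau u < r" "r \<le> ?e" for r
    proof (cases "r = tau v")
      case True
      then have "v < sink"
        using that tau_le_n_iff[of v] by (simp add: end_time_def)
      then show ?thesis
        using True g g_last in_tubeD[OF x(1), of r] that by (simp add: end_time_def)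
    next
      case False
      then show ?thesis
        using that l(3)[of r] l1 g by (simp add: end_time_def)
    qed
    then have "edge u v"
      using uv by (auto simp: edge_def)
    moreover have "edge_var u v \<le> var x ?s ?e"
    proof (cases "u = 0")
      case True
      then have "edge_var u v = 0"
        using fill_eq by (intro var_const) auto
      then show ?thesis by (simp add: var_nonneg)
    next
      case False
      then show ?thesis
        using var_g g max_tau_1[OF False] by simp
    qed
    ultimately show ?thesis by blast
  qed
qed

lemma const_if_no_jump:
  fixes x :: "nat \<Rightarrow> real"
  assumes "\<And>i. s < i \<Longrightarrow> i \<le> e \<Longrightarrow> x i = x (i - 1)" "s \<le> r" "r \<le> e"
  shows "x r = x s"
  using assms(2,3)
proof (induction r rule: dec_induct)
  case (step r)
  then show ?case
    using assms(1)[of "Suc r"] by simp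
qed simp

lemma var_ge_1:
  assumes "q = 0" "x s \<noteq> x e" "s \<le> e"
  shows "1 \<le> var x s e"
proof -
  have "\<exists>r. s < r \<and> r \<le> e \<and> x r \<noteq> x (r - 1)"
  proof (rule ccontr)
    assume "\<not> ?thesis"
    then have "x e = x s"
      using assms(3) by (intro const_if_no_jump[of s e]) auto
    then show False
      using assms(2) by simp
  qed
  then obtain r where r: "s < r" "r \<le> e" "x r \<noteq> x (r - 1)"
    by blast
  then have "abs_pow q (x r - x (r - 1)) = 1"
    by (simp add: abs_pow_def assms(1))
  moreover have "abs_pow q (x r - x (r - 1)) \<le> var x s e"
    unfolding var_def using r by (intro member_le_sum) auto
  ultimately show ?thesis by simp
qed

text \<open>
  For \<open>q = 0\<close> the variation counts jumps. A constant block between two jumps can be moved as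
  a whole without creating a jump, until it touches a barrier; a block at a free end of the
  sequence behaves in the same way, which is why the times \<open>1\<close> and \<open>n + 1\<close> are counted as
  jumps in \<open>A\<close> below. If there is no such block, \<open>x\<close> has at most one jump, and delaying this
  jump as long as the first value is allowed stays in the tube: at any later time \<open>x\<close> itself
  has the second value.
\<close>

lemma edge_or_improvement_jumps:
  assumes q0: "q = 0" and uv: "tau u < tau v" "v \<le> sink"
    and x: "in_tube x" "u \<noteq> 0 \<Longrightarrow> x (tau u) = val u" "v < sink \<Longrightarrow> x (tau v) = val v"
  shows "edge u v \<and> edge_var u v \<le> var x (max (tau u) 1) (end_time v) \<or>
    (\<exists>y. in_tube y \<and> (\<forall>r. r \<notin> {tau u<..<tau v} \<longrightarrow> y r = x r) \<and>
       (\<exists>r\<in>{tau u<..<tau v}. y r \<in> {a r, b r}) \<and>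
       var y (max (tau u) 1) (end_time v) \<le> var x (max (tau u) 1) (end_time v))"
proof -
  let ?s = "max (tau u) 1" and ?e = "end_time v" and ?J = "{tau u<..<tau v}"
  have nq: "\<not> 1 \<le> q"
    using q0 by simp
  have v_pos: "0 < v"
    using tau_less_imp_less[OF uv(1)] by simp
  have tau_v: "tau v \<le> Suc n"
    using tau_mono[OF uv(2)] by simp
  \<comment> \<open>The times at which a constant block of \<open>x\<close> begins or ends and can be detached from its neighbour.\<close>
  define A where "A = {r \<in> {tau u<..tau v}. r = 1 \<or> r = Suc n \<or> x r \<noteq> x (r - 1)}"
  show ?thesis
  proof (cases "\<exists>j\<in>A. \<exists>e\<in>A. j < e")
    case True
    then obtain j e' where je': "j \<in> A" "e' \<in> A" "j < e'"
      by blast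
    \<comment> \<open>\<open>j\<close> and \<open>e\<close> are consecutive in \<open>A\<close>, so that \<open>x\<close> is constant on the block from \<open>j\<close> to \<open>e - 1\<close>.\<close>
    define e where "e = (LEAST e. e \<in> A \<and> j < e)"
    have e: "e \<in> A" "j < e"
      unfolding e_def using LeastI[of "\<lambda>e. e \<in> A \<and> j < e" e'] je' by auto
    have no_jump: "r \<notin> A" if "j < r" "r < e" for r
      using Least_le[of "\<lambda>e. e \<in> A \<and> j < e" r] that by (auto simp: e_def)
    define K where "K = {j..<e}"
    have K: "K \<subseteq> ?J" "j \<in> K"
      using je'(1) e by (auto simp: K_def A_def)
    have K_tube: "a r \<le> x r \<and> x r \<le> b r" if "r \<in> K" for r
      using that K(1) tau_v by (intro in_tubeD[OF x(1)]) auto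
    have x_const: "x r = x j" if "r \<in> K" for r
    proof (rule const_if_no_jump[of j "e - 1"])
      fix i assume "j < i" "i \<le> e - 1"
      then show "x i = x (i - 1)"
        using no_jump[of i] je'(1) e(1) by (auto simp: A_def)
    qed (use that in \<open>auto simp: K_def\<close>)
    obtain l where l: "0 \<le> l" "l \<le> 1"
      "\<And>r. r \<in> K \<Longrightarrow> a r \<le> x r + l * (a j - x r) \<and> x r + l * (a j - x r) \<le> b r"
      "l = 1 \<or> (\<exists>r\<in>K. x r + l * (a j - x r) \<in> {a r, b r})"
      using homotopy_touches[of K a x b "\<lambda>_. a j"] K_tube K_def
      by (metis atLeastAtMost_iff finite_atLeastLessThan)
    define y where "y r = (if r \<in> K then x r + l * (a j - x r) else x r)" for r
    have "in_tube y"
      using l(3) x(1) by (auto simp: in_tube_def y_def)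
    moreover have "\<exists>r\<in>?J. y r \<in> {a r, b r}"
    proof (cases "l = 1")
      case True
      then have "y j = a j"
        using K(2) by (simp add: y_def)
      then show ?thesis
        using K by blast
    next
      case False
      then show ?thesis
        using l(4) K(1) by (auto simp: y_def)
    qed
    moreover have "var y ?s ?e \<le> var x ?s ?e"
    proof (rule var_mono)
      fix r assume r: "?s < r" "r \<le> ?e"
      then have r1: "1 < r" "r \<le> n"
        by (auto simp: end_time_def)
      have le_1: "abs_pow q z \<le> 1" for z
        using q0 by (simp add: abs_pow_def)
      have "r \<in> K \<longleftrightarrow> r - 1 \<in> K" if "r \<noteq> j" "r \<noteq> e"
        using that r1 by (auto simp: K_def)
      then consider "r \<in> K \<longleftrightarrow> r - 1 \<in> K" | "r = j" | "r = e"
        by blast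
      then show "abs_pow q (y r - y (r - 1)) \<le> abs_pow q (x r - x (r - 1))"
      proof cases
        case 1
        then show ?thesis
          using x_const[of r] x_const[of "r - 1"] by (auto simp: y_def)
      next
        case 2
        then have "abs_pow q (x r - x (r - 1)) = 1"
          using je'(1) r1 q0 by (simp add: A_def abs_pow_def)
        then show ?thesis using le_1 by simp
      next
        case 3
        then have "abs_pow q (x r - x (r - 1)) = 1"
          using e(1) r1 q0 by (simp add: A_def abs_pow_def)
        then show ?thesis using le_1 by simp
      qed
    qed
    ultimately show ?thesis
      using K(1) by (intro disjI2 exI[of _ y]) (auto simp: y_def)
  next
    case single: False
    let ?p = "first_val u v" and ?f = "last_val u v"
    have phases: "x r = ?p \<or> (\<forall>r'\<in>{r..?e}. x r' = ?f)" if r: "?s \<le> r" "r \<le> ?e" for r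
    proof (cases "\<exists>j\<in>A. j \<le> r")
      case True
      then have no_jump: "i \<notin> A" if "r < i" for i
        using single that by fastforce
      have v: "v < sink"
      proof (rule ccontr)
        assume "\<not> v < sink"
        then have "v = sink"
          using uv(2) by simp
        then have "Suc n \<in> A"
          using uv(1) by (auto simp: A_def)
        then show False
          using no_jump[of "Suc n"] r by (simp add: end_time_def)
      qed
      have const: "x r' = x r" if "r \<le> r'" "r' \<le> tau v" for r'
      proof (rule const_if_no_jump[of r "tau v"])
        fix i assume "r < i" "i \<le> tau v"
        then show "x i = x (i - 1)"
          using no_jump[of i] r by (auto simp: A_def)
      qed (use that in auto)
      have "r \<le> tau v"
        using r by (simp add: end_time_def)
      then have "x r = ?f"
        using const[of "tau v"] x(3)[OF v] v by (simp add: last_val_def)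
      then show ?thesis
        using const by (auto simp: end_time_def)
    next
      case False
      have u: "u \<noteq> 0"
      proof
        assume "u = 0"
        then have "1 \<in> A"
          using uv(1) by (simp add: A_def)
        then show False
          using False r by auto
      qed
      have "x r = x (tau u)"
      proof (rule const_if_no_jump[of "tau u" r])
        fix i assume i: "tau u < i" "i \<le> r"
        then have "i \<notin> A"
          using False by auto
        then show "x i = x (i - 1)"
          using i r by (auto simp: A_def end_time_def)
      qed (use r in auto)
      then show ?thesis
        using x(2) u by (simp add: first_val_def)
    qed
    have inv: "(r = tau u \<or> a r \<le> fill u v r \<and> fill u v r \<le> b r) \<and>
      (fill u v r = ?p \<and> var (fill u v) (tau u) r = 0 \<or>
       fill u v r = ?f \<and> var (fill u v) (tau u) r \<le> of_bool (?p \<noteq> ?f) \<and> (\<forall>r'\<in>{r..?e}. x r' = ?f))"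
      if "tau u \<le> r" "r \<le> ?e" for r
      using that
    proof (induction r rule: dec_induct)
      case base
      then show ?case
        by (simp add: fill_before var_def)
    next
      case (step r)
      have r: "1 \<le> Suc r" "Suc r \<le> n" "Suc r \<le> tau v" "tau u < Suc r"
        using step by (auto simp: end_time_def)
      have stay: "fill u v (Suc r) = (if a (Suc r) \<le> fill u v r \<and> fill u v r \<le> b (Suc r) \<and> Suc r < tau v
          then fill u v r else ?f)"
        using fill_stay[OF nq r(4), of v] by simp
      have f_ok: "a (Suc r) \<le> ?f \<and> ?f \<le> b (Suc r)" if "\<forall>r'\<in>{Suc r..?e}. x r' = ?f"
        using that in_tubeD[OF x(1) r(1,2)] step.prems by force
      have IH: "fill u v r = ?p \<and> var (fill u v) (tau u) r = 0 \<or>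
         fill u v r = ?f \<and> var (fill u v) (tau u) r \<le> of_bool (?p \<noteq> ?f) \<and> (\<forall>r'\<in>{r..?e}. x r' = ?f)"
        using step.IH step.prems by simp
      then show ?case
      proof (elim disjE)
        assume p: "fill u v r = ?p \<and> var (fill u v) (tau u) r = 0"
        show ?thesis
        proof (cases "a (Suc r) \<le> ?p \<and> ?p \<le> b (Suc r) \<and> Suc r < tau v")
          case True
          then have "fill u v (Suc r) = ?p"
            using p stay by simp
          then show ?thesis
            using p True step.hyps by (simp add: var_Suc)
        next
          case False
          then have f: "fill u v (Suc r) = ?f"
            using stay p by metis
          have const: "\<forall>r'\<in>{Suc r..?e}. x r' = ?f"
          proof (cases "Suc r = tau v")
            case True
            then have "v < sink"
              using r(2) tau_le_n_iff[of v] by simp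
            then show ?thesis
              using True x(3) by (auto simp: last_val_def end_time_def)
          next
            case not_end: False
            then have "x (Suc r) \<noteq> ?p"
              using False in_tubeD[OF x(1) r(1,2)] r(3) by auto
            then show ?thesis
              using phases[of "Suc r"] step by auto
          qed
          have "abs_pow q (?f - ?p) \<le> of_bool (?p \<noteq> ?f)"
            using q0 by (simp add: abs_pow_def)
          then have "var (fill u v) (tau u) (Suc r) \<le> of_bool (?p \<noteq> ?f)"
            using f p step.hyps by (simp only: var_Suc)
          then show ?thesis
            using const f_ok[OF const] unfolding f by blast
        qed
      next
        assume f: "fill u v r = ?f \<and> var (fill u v) (tau u) r \<le> of_bool (?p \<noteq> ?f) \<and> (\<forall>r'\<in>{r..?e}. x r' = ?f)"
        then have fS: "fill u v (Suc r) = ?f"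
          using stay by simp
        have const: "\<forall>r'\<in>{Suc r..?e}. x r' = ?f"
          using f by simp
        have "var (fill u v) (tau u) (Suc r) \<le> of_bool (?p \<noteq> ?f)"
          using f fS step.hyps by (simp add: var_Suc)
        then show ?thesis
          using const f_ok[OF const] unfolding fS by blast
      qed
    qed
    have "tau u \<le> ?e"
      using uv tau_v by (simp add: end_time_def)
    then have "edge_var u v \<le> of_bool (?p \<noteq> ?f)"
      using inv[of ?e] by auto
    also have "\<dots> \<le> var x ?s ?e"
    proof (cases "?p = ?f")
      case False
      then have u: "u \<noteq> 0" and v: "v < sink"
        by (auto simp: first_val_def last_val_def split: if_splits)
      have e: "?e = tau v"
        using v tau_le_n_iff[of v] by (simp add: end_time_def)
      have "1 \<le> var x (tau u) (tau v)"
        using x u v uv(1) False v_pos by (intro var_ge_1[OF q0]) (auto simp: first_val_def last_val_def)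
      then show ?thesis
        using max_tau_1[OF u] e by simp
    qed (simp add: var_nonneg)
    finally have "edge_var u v \<le> var x ?s ?e" .
    moreover have "a r \<le> fill u v r \<and> fill u v r \<le> b r" if "tau u < r" "r \<le> ?e" for r
      using inv[of r] that by simp
    then have "edge u v"
      using uv(1) by (simp add: edge_def)
    ultimately show ?thesis by blast
  qed
qed

text \<open>
  Induction on the distance of the two nodes. At a knot strictly between them the stretch is
  split. Without such a knot all entries in between are nonzero, so neither taking the edge
  nor passing to the improved sequence can enlarge the support, even though both may move
  the entries freely.
\<close>

lemma walk_segment:
  assumes "walk u k c" "tau u < tau v" "v \<le> sink" "in_tube x"
    "u \<noteq> 0 \<Longrightarrow> x (tau u) = val u" "v < sink \<Longrightarrow> x (tau v) = val v"
  shows "\<exists>k' c'. walk v k' c' \<and> k' \<le> k + supp x (tau u) (end_time v) \<and>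
    c' \<le> c + var x (max (tau u) 1) (end_time v)"
  using assms
proof (induction "tau v - tau u" arbitrary: u v k c x rule: less_induct)
  case less
  let ?s = "max (tau u) 1" and ?e = "end_time v" and ?J = "{tau u<..<tau v}"
  have tau_v: "tau v \<le> Suc n"
    using tau_mono[OF less.prems(3)] by simp
  have split: "\<exists>k' c'. walk v k' c' \<and> k' \<le> k + supp y (tau u) ?e \<and> c' \<le> c + var y ?s ?e"
    if y: "in_tube y" "u \<noteq> 0 \<Longrightarrow> y (tau u) = val u" "v < sink \<Longrightarrow> y (tau v) = val v"
      and r: "r \<in> ?J" "y r \<in> {0, a r, b r}" for y r
  proof -
    have "1 \<le> r"
      using r(1) by simp
    from ex_node_iff[OF this, of a b "y r"] r(2) obtain w where w: "tau w = r" "val w = y r"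
      by auto
    have w': "w < sink" "w \<noteq> 0"
      using w r(1) tau_v tau_le_n_iff[of w] by (cases "w = 0"; auto)+
    have "\<exists>k' c'. walk w k' c' \<and> k' \<le> k + supp y (tau u) (end_time w) \<and>
        c' \<le> c + var y ?s (end_time w)"
      using less.prems(1) y w w' r(1) by (intro less.hyps) auto
    then obtain k1 c1 where 1: "walk w k1 c1" "k1 \<le> k + supp y (tau u) (end_time w)"
      "c1 \<le> c + var y ?s (end_time w)"
      by blast
    have "\<exists>k' c'. walk v k' c' \<and> k' \<le> k1 + supp y (tau w) ?e \<and> c' \<le> c1 + var y (max (tau w) 1) ?e"
      using less.prems(3) y w w' r(1) by (intro less.hyps[OF _ 1(1)]) auto
    then obtain k2 c2 where 2: "walk v k2 c2" "k2 \<le> k1 + supp y (tau w) ?e"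
      "c2 \<le> c1 + var y (max (tau w) 1) ?e"
      by blast
    have ends: "end_time w = r" "max (tau w) 1 = r" "?s \<le> r" "tau u \<le> r" "r \<le> ?e"
      using w r(1) tau_v by (auto simp: end_time_def)
    show ?thesis
      using 1(2,3) 2 ends w(1) var_split[of ?s r ?e y] supp_split[of "tau u" r ?e y]
      by (intro exI[of _ k2] exI[of _ c2]) auto
  qed
  show ?case
  proof (cases "\<exists>r\<in>?J. x r \<in> {0, a r, b r}")
    case True
    then show ?thesis
      using split[of x] less.prems by blast
  next
    case no_knot: False
    have "edge u v \<and> edge_var u v \<le> var x ?s ?e \<or>
      (\<exists>y. in_tube y \<and> (\<forall>r. r \<notin> ?J \<longrightarrow> y r = x r) \<and> (\<exists>r\<in>?J. y r \<in> {a r, b r}) \<and>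
         var y ?s ?e \<le> var x ?s ?e)"
      using q edge_or_improvement_jumps[OF _ less.prems(2-6)]
        edge_or_improvement_convex[OF _ less.prems(2-6)] by blast
    then show ?thesis
    proof (elim disjE exE conjE)
      assume e: "edge u v" "edge_var u v \<le> var x ?s ?e"
      have "fill u v r \<noteq> 0 \<longrightarrow> x r \<noteq> 0" if "tau u < r" "r \<le> ?e" for r
      proof (cases "r = tau v")
        case True
        then have "v < sink"
          using that tau_le_n_iff[of v] by (simp add: end_time_def)
        then show ?thesis
          using True less.prems(2,6) by (simp add: fill_end last_val_def)
      next
        case False
        then show ?thesis
          using that no_knot by (auto simp: end_time_def)
      qed
      then have "edge_supp u v \<le> supp x (tau u) ?e"
        unfolding supp_def by (intro card_mono) auto
      then show ?thesis
        using walk.step[OF less.prems(1) e(1) less.prems(3)] e(2)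
        by (intro exI conjI) auto
    next
      fix y
      assume y: "in_tube y" "\<forall>r. r \<notin> ?J \<longrightarrow> y r = x r" "\<exists>r\<in>?J. y r \<in> {a r, b r}"
        "var y ?s ?e \<le> var x ?s ?e"
      then obtain r where r: "r \<in> ?J" "y r \<in> {0, a r, b r}"
        by blast
      have "\<exists>k' c'. walk v k' c' \<and> k' \<le> k + supp y (tau u) ?e \<and> c' \<le> c + var y ?s ?e"
        using y less.prems r by (intro split[of y r]) auto
      moreover have "supp y (tau u) ?e \<le> supp x (tau u) ?e"
        unfolding supp_def using y(2) no_knot by (intro card_mono) force+
      ultimately show ?thesis
        using y(4) by (meson add_left_mono le_trans order_trans)
    qed
  qed
qed

theorem ex_walk:
  assumes "in_tube x"
  shows "\<exists>k c. walk sink k c \<and> k \<le> supp x 0 n \<and> c \<le> var x 1 n"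
proof -
  have "end_time sink = n"
    by (simp add: end_time_def)
  moreover have "\<exists>k c. walk sink k c \<and> k \<le> 0 + supp x (tau 0) (end_time sink) \<and>
      c \<le> 0 + var x (max (tau 0) 1) (end_time sink)"
    using assms by (intro walk_segment walk.start) auto
  ultimately show ?thesis
    by simp
qed

end

section \<open>Total correctness with time bounds\<close>

text \<open>
  The postcondition also receives the unspent part of the budget. In this form the rules for
  programs without loops are equations, so that the simplifier executes such programs
  symbolically.
\<close>

definition wp :: "real \<Rightarrow> com \<Rightarrow> store \<Rightarrow> nat \<Rightarrow> (nat \<Rightarrow> store \<Rightarrow> bool) \<Rightarrow> bool" where
  "wp q c s B Q \<longleftrightarrow> (\<exists>n s'. exec q c s n s' \<and> n \<le> B \<and> Q (B - n) s')"

abbreviation runs :: "real \<Rightarrow> com \<Rightarrow> store \<Rightarrow> nat \<Rightarrow> (store \<Rightarrow> bool) \<Rightarrow> bool" where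
  "runs q c s B Q \<equiv> wp q c s B (\<lambda>_. Q)"

notation Sequ (infixr ";;" 60)

inductive_cases SkipE: "exec q Skip s n s'"
inductive_cases NAssignE: "exec q (NAssign a is e) s n s'"
inductive_cases RAssignE: "exec q (RAssign a is e) s n s'"
inductive_cases SequE: "exec q (Sequ c d) s n s'"
inductive_cases CondE: "exec q (Cond b c d) s n s'"

lemma wp_Skip [simp]: "wp q Skip s B Q \<longleftrightarrow> 1 \<le> B \<and> Q (B - 1) s"
proof -
  have "exec q Skip s n s' \<longleftrightarrow> n = 1 \<and> s' = s" for n s'
    using exec.Skip[of q s] by (auto simp only: elim: SkipE)
  then show ?thesis
    unfolding wp_def by auto
qed

lemma wp_NAssign [simp]: "wp q (NAssign a is e) s B Q \<longleftrightarrow>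
    1 + sum_list (map ncost is) + ncost e \<le> B \<and>
    Q (B - (1 + sum_list (map ncost is) + ncost e))
      (s\<lparr>nats := (nats s)((a, map (nval s) is) := nval s e)\<rparr>)"
proof -
  have "exec q (NAssign a is e) s n s' \<longleftrightarrow> n = 1 + sum_list (map ncost is) + ncost e \<and>
      s' = s\<lparr>nats := (nats s)((a, map (nval s) is) := nval s e)\<rparr>" for n s'
    using exec.NAssign[of q a "is" e s] by (auto simp only: elim: NAssignE)
  then show ?thesis
    unfolding wp_def by auto
qed

lemma wp_RAssign [simp]: "wp q (RAssign a is e) s B Q \<longleftrightarrow>
    1 + sum_list (map ncost is) + rcost e \<le> B \<and>
    Q (B - (1 + sum_list (map ncost is) + rcost e))
      (s\<lparr>reals := (reals s)((a, map (nval s) is) := rval q s e)\<rparr>)"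
proof -
  have "exec q (RAssign a is e) s n s' \<longleftrightarrow> n = 1 + sum_list (map ncost is) + rcost e \<and>
      s' = s\<lparr>reals := (reals s)((a, map (nval s) is) := rval q s e)\<rparr>" for n s'
    using exec.RAssign[of q a "is" e s] by (auto simp only: elim: RAssignE)
  then show ?thesis
    unfolding wp_def by auto
qed

lemma wp_Sequ [simp]: "wp q (c ;; d) s B Q \<longleftrightarrow> wp q c s B (\<lambda>B' s'. wp q d s' B' Q)"
proof
  assume "wp q (c ;; d) s B Q"
  then obtain n k s' s'' where "exec q c s n s'" "exec q d s' k s''" "n + k \<le> B" "Q (B - (n + k)) s''"
    by (auto simp: wp_def elim!: SequE)
  then show "wp q c s B (\<lambda>B' s'. wp q d s' B' Q)"
    unfolding wp_def by (intro exI[of _ n] exI[of _ s'] exI[of _ k] exI[of _ s''] conjI) auto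
next
  assume "wp q c s B (\<lambda>B' s'. wp q d s' B' Q)"
  then obtain n k s' s'' where "exec q c s n s'" "exec q d s' k s''" "n \<le> B" "k \<le> B - n"
    "Q (B - n - k) s''"
    by (auto simp: wp_def)
  then show "wp q (c ;; d) s B Q"
    unfolding wp_def using exec.Sequ[of q c s n s' d k s'']
    by (intro exI[of _ "n + k"] exI[of _ s'']) auto
qed

lemma wp_Cond [simp]: "wp q (Cond b c d) s B Q \<longleftrightarrow>
    tcost b \<le> B \<and> (if tval q s b then wp q c s (B - tcost b) Q else wp q d s (B - tcost b) Q)"
proof -
  let ?branch = "if tval q s b then c else d"
  have "wp q (Cond b c d) s B Q \<longleftrightarrow> tcost b \<le> B \<and> wp q ?branch s (B - tcost b) Q"
  proof
    assume "wp q (Cond b c d) s B Q"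
    then obtain n s' where ns: "exec q (Cond b c d) s n s'" "n \<le> B" "Q (B - n) s'"
      by (auto simp: wp_def)
    from this(1) obtain k where "exec q ?branch s k s'" "n = tcost b + k"
      by (auto elim!: CondE)
    then show "tcost b \<le> B \<and> wp q ?branch s (B - tcost b) Q"
      unfolding wp_def using ns by (intro conjI exI[of _ k] exI[of _ s']) auto
  next
    assume r: "tcost b \<le> B \<and> wp q ?branch s (B - tcost b) Q"
    then obtain k s' where k: "exec q ?branch s k s'" "k \<le> B - tcost b" "Q (B - tcost b - k) s'"
      by (auto simp: wp_def)
    then have "exec q (Cond b c d) s (tcost b + k) s'"
      using exec.CondTrue[of q s b c k s' d] exec.CondFalse[of q s b d k s' c] by (auto split: if_splits)
    then show "wp q (Cond b c d) s B Q"
      unfolding wp_def using r k by (intro exI[of _ "tcost b + k"] exI[of _ s']) auto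
  qed
  then show ?thesis
    by simp
qed

text \<open>
  Without this congruence rule the simplifier would work on the continuation \<open>Q\<close> for an
  unknown store first, which makes terms explode.
\<close>

lemma wp_weak_cong [cong]: "s = s' \<Longrightarrow> B = B' \<Longrightarrow> wp q c s B Q = wp q c s' B' Q"
  by simp

lemma wp_mono:
  assumes "wp q c s B Q" "B \<le> B'" "\<And>k k' s'. Q k s' \<Longrightarrow> k \<le> k' \<Longrightarrow> Q' k' s'"
  shows "wp q c s B' Q'"
proof -
  obtain n s' where "exec q c s n s'" "n \<le> B" "Q (B - n) s'"
    using assms(1) by (auto simp: wp_def)
  then show ?thesis
    unfolding wp_def using assms(2,3) by (intro exI[of _ n] exI[of _ s']) (auto intro: diff_le_mono)
qed

lemma runs_mono: "runs q c s B Q \<Longrightarrow> B \<le> B' \<Longrightarrow> (\<And>s'. Q s' \<Longrightarrow> Q' s') \<Longrightarrow> runs q c s B' Q'"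
  by (rule wp_mono)

lemma runs_Sequ:
  assumes "runs q c s Bc Q" "\<And>s'. Q s' \<Longrightarrow> runs q d s' Bd R" "Bc + Bd \<le> B"
  shows "runs q (c ;; d) s B R"
proof -
  obtain n s' where 1: "exec q c s n s'" "n \<le> Bc" "Q s'"
    using assms(1) by (auto simp: wp_def)
  then obtain k s'' where "exec q d s' k s''" "k \<le> Bd" "R s''"
    using assms(2)[OF 1(3)] by (auto simp: wp_def)
  then show ?thesis
    unfolding wp_def using 1 assms(3) exec.Sequ by (metis add_mono le_trans)
qed

primrec writes :: "com \<Rightarrow> string set" where
  "writes Skip = {}"
| "writes (NAssign a is e) = {a}"
| "writes (RAssign a is e) = {a}"
| "writes (Sequ c d) = writes c \<union> writes d"
| "writes (Cond b c d) = writes c \<union> writes d"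
| "writes (While b c) = writes c"

text \<open>
  Arrays are the unit of framing: a program changes only arrays that occur as targets in its
  text.
\<close>

definition same_outside :: "string set \<Rightarrow> store \<Rightarrow> store \<Rightarrow> bool" where
  "same_outside W s s' \<longleftrightarrow>
     (\<forall>a is. a \<notin> W \<longrightarrow> nats s' (a, is) = nats s (a, is) \<and> reals s' (a, is) = reals s (a, is))"

lemma same_outside_nats: "same_outside W s s' \<Longrightarrow> a \<notin> W \<Longrightarrow> nats s' (a, is) = nats s (a, is)"
  and same_outside_reals: "same_outside W s s' \<Longrightarrow> a \<notin> W \<Longrightarrow> reals s' (a, is) = reals s (a, is)"
  by (simp_all add: same_outside_def)

lemma same_outside_refl [simp]: "same_outside W s s"
  by (simp add: same_outside_def)

lemma exec_same_outside: "exec q c s n s' \<Longrightarrow> same_outside (writes c) s s'"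
  by (induction rule: exec.induct) (auto simp: same_outside_def)

lemma runs_frame:
  assumes "runs q c s B (\<lambda>s'. same_outside (writes c) s s' \<longrightarrow> Q s')"
  shows "runs q c s B Q"
  using assms exec_same_outside unfolding wp_def by blast

lemma runs_with_frame:
  assumes "runs q c s B Q"
  shows "runs q c s B (\<lambda>s'. same_outside (writes c) s s' \<and> Q s')"
  by (rule runs_frame, rule runs_mono[OF assms order_refl]) simp

definition For :: "string \<Rightarrow> nexp \<Rightarrow> nexp \<Rightarrow> com \<Rightarrow> com" where
  "For v lo hi c = (NAssign v [] lo ;; While (NLess (NCell v []) hi)
     (c ;; NAssign v [] (NAdd (NCell v []) (NConst 1))))"

lemma writes_For [simp]: "writes (For v lo hi c) = insert v (writes c)"
  by (auto simp: For_def)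

abbreviation set_nat :: "store \<Rightarrow> string \<Rightarrow> nat \<Rightarrow> store" where
  "set_nat s v k \<equiv> s\<lparr>nats := (nats s)((v, []) := k)\<rparr>"

text \<open>
  The invariant \<open>I k\<close> speaks about the store in which the counter already has the value \<open>k\<close>.
  Everything that the loop does not write is available from the frame, in the body relative
  to the store \<open>s\<close> before the loop, so invariants need to mention only what changes.
\<close>

lemma runs_For:
  assumes v: "v \<notin> writes c"
    and lo: "nval s lo = L"
    and hi: "\<And>s'. same_outside (insert v (writes c)) s s' \<Longrightarrow> nval s' hi = H"
    and LH: "L \<le> H"
    and init: "I L (set_nat s v L)"
    and step: "\<And>k s'. L \<le> k \<Longrightarrow> k < H \<Longrightarrow> nats s' (v, []) = k \<Longrightarrow>
      same_outside (insert v (writes c)) s s' \<Longrightarrow> I k s' \<Longrightarrow>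
      runs q c s' B (\<lambda>s''. same_outside (writes c) s' s'' \<longrightarrow> I (Suc k) (set_nat s'' v (Suc k)))"
    and post: "\<And>s'. same_outside (insert v (writes c)) s s' \<Longrightarrow> I H s' \<Longrightarrow> Q s'"
    and time: "(H - L) * (B + ncost hi + 6) + ncost lo + ncost hi + 3 \<le> B'"
  shows "runs q (For v lo hi c) s B' Q"
proof -
  let ?W = "insert v (writes c)"
  let ?body = "c ;; NAssign v [] (NAdd (NCell v []) (NConst 1))"
  let ?loop = "While (NLess (NCell v []) hi) ?body"
  have loop: "runs q ?loop s' ((H - k) * (B + ncost hi + 6) + ncost hi + 2) Q"
    if "L \<le> k" "k \<le> H" "nats s' (v, []) = k" "same_outside ?W s s'" "I k s'" for k s'
    using that
  proof (induction "H - k" arbitrary: k s')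
    case 0
    then have "\<not> tval q s' (NLess (NCell v []) hi)"
      using hi by simp
    then have "exec q ?loop s' (tcost (NLess (NCell v []) hi)) s'"
      by (rule exec.WhileFalse)
    then show ?case
      using 0 post by (auto simp: wp_def)
  next
    case (Suc d)
    have k: "k < H"
      using Suc.hyps(2) by simp
    then have t: "tval q s' (NLess (NCell v []) hi)"
      using hi Suc.prems by simp
    obtain n s1 where 1: "exec q c s' n s1" "n \<le> B" "I (Suc k) (set_nat s1 v (Suc k))"
      using step[OF Suc.prems(1) k Suc.prems(3-5)] exec_same_outside by (auto simp: wp_def)
    let ?s2 = "set_nat s1 v (Suc k)"
    have so: "same_outside (writes c) s' s1"
      by (rule exec_same_outside[OF 1(1)])
    then have "nats s1 (v, []) = k"
      using Suc.prems v by (simp add: same_outside_nats)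
    then have body: "exec q ?body s' (n + 4) ?s2"
      using exec.Sequ[OF 1(1) exec.NAssign[of q v "[]" "NAdd (NCell v []) (NConst 1)" s1]]
      by (simp add: numeral_eq_Suc)
    have "runs q ?loop ?s2 ((H - Suc k) * (B + ncost hi + 6) + ncost hi + 2) Q"
    proof (rule Suc.hyps(1))
      show "same_outside ?W s ?s2"
        using Suc.prems(4) so by (auto simp: same_outside_def)
    qed (use Suc.hyps(2) Suc.prems k 1(3) in auto)
    then obtain m s3 where 3: "exec q ?loop ?s2 m s3"
      "m \<le> (H - Suc k) * (B + ncost hi + 6) + ncost hi + 2" "Q s3"
      by (auto simp: wp_def)
    have "exec q ?loop s' (tcost (NLess (NCell v []) hi) + (n + 4) + m) s3"
      by (rule exec.WhileTrue[OF t body 3(1)])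
    moreover have "H - k = Suc (H - Suc k)"
      using k by simp
    then have "tcost (NLess (NCell v []) hi) + (n + 4) + m
        \<le> (H - k) * (B + ncost hi + 6) + ncost hi + 2"
      using 1(2) 3(2) by simp
    ultimately show ?case
      using 3(3) unfolding wp_def by blast
  qed
  have "runs q ?loop (set_nat s v L) ((H - L) * (B + ncost hi + 6) + ncost hi + 2) Q"
    using LH init by (intro loop) (auto simp: same_outside_def)
  then have "runs q (For v lo hi c) s (1 + ncost lo + ((H - L) * (B + ncost hi + 6) + ncost hi + 2)) Q"
    unfolding For_def using lo by simp
  then show ?thesis
    by (rule runs_mono) (use time in auto)
qed

section \<open>The program\<close>

abbreviation NV :: "string \<Rightarrow> nexp" where "NV x \<equiv> NCell x []"
abbreviation RV :: "string \<Rightarrow> rexp" where "RV x \<equiv> RCell x []"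

definition thrice :: "nexp \<Rightarrow> nexp" where
  "thrice e = NAdd e (NAdd e e)"

lemma nval_thrice [simp]: "nval s (thrice e) = 3 * nval s e"
  by (simp add: thrice_def)

lemma ncost_thrice [simp]: "ncost (thrice e) = 2 + 3 * ncost e"
  by (simp add: thrice_def)

text \<open>
  Roles of the arrays: \<open>rn\<close> holds the times as real numbers, as there is no conversion;
  \<open>tau\<close> and \<open>val\<close> describe the nodes, and \<open>val\<close> at \<open>3 r - 1\<close> and \<open>3 r\<close> also serves as the
  table of the barriers. For a fixed target \<open>v\<close> the arrays \<open>F\<close>, \<open>ok\<close>, \<open>w\<close>, \<open>inc\<close> hold, for
  each origin \<open>u\<close>, the entries proposed by the edge, its availability, its variation and its
  number of nonzero entries. For each node \<open>v\<close> and bound \<open>k\<close> on the number of nonzero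
  entries, \<open>X\<close> holds the best sequence found up to \<open>v\<close>, \<open>V\<close> its variation and \<open>P\<close> the number
  of the preceding node plus one, where 0 means that there is no such sequence; the source,
  which has no predecessor, gets 1.

  The inputs \<open>m\<close> and \<open>lambda\<close> start at time 0, so time \<open>r\<close> of the tube is time \<open>r - 1\<close> of
  the input. For \<open>t = 0\<close> the three addresses below coincide by truncation, and node 0 gets
  the time 0.
\<close>

definition node_com :: com where
  "node_com =
    (RAssign ''rn'' [NV ''t''] (RV ''c'') ;;
     RAssign ''c'' [] (RAdd (RV ''c'') (RConst 1)) ;;
     NAssign ''tau'' [NSub (thrice (NV ''t'')) (NConst 2)] (NV ''t'') ;;
     NAssign ''tau'' [NSub (thrice (NV ''t'')) (NConst 1)] (NV ''t'') ;;
     NAssign ''tau'' [thrice (NV ''t'')] (NV ''t'') ;;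
     RAssign ''val'' [NSub (thrice (NV ''t'')) (NConst 2)] (RConst 0) ;;
     RAssign ''val'' [NSub (thrice (NV ''t'')) (NConst 1)]
       (RSub (RCell ''m'' [NSub (NV ''t'') (NConst 1), NV ''i''])
             (RCell ''lambda'' [NSub (NV ''t'') (NConst 1)])) ;;
     RAssign ''val'' [thrice (NV ''t'')]
       (RAdd (RCell ''m'' [NSub (NV ''t'') (NConst 1), NV ''i''])
             (RCell ''lambda'' [NSub (NV ''t'') (NConst 1)])))"

definition nodes_com :: com where
  "nodes_com = (RAssign ''c'' [] (RConst 0) ;;
    For ''t'' (NConst 0) (NAdd (NV ''n'') (NConst 2)) node_com)"

definition fill_com :: "real \<Rightarrow> com" where
  "fill_com q =
    (if 1 \<le> q then
       RAssign ''F'' [NV ''u'', NV ''r'']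
         (RAdd (RV ''first'')
           (RDiv (RMul (RSub (RCell ''rn'' [NV ''r'']) (RCell ''rn'' [NCell ''tau'' [NV ''u'']]))
                       (RSub (RV ''last'') (RV ''first'')))
                 (RSub (RCell ''rn'' [NCell ''tau'' [NV ''v'']]) (RCell ''rn'' [NCell ''tau'' [NV ''u'']]))))
     else
       Cond
         (TAnd (TNot (RLess (RCell ''F'' [NV ''u'', NSub (NV ''r'') (NConst 1)])
                            (RCell ''val'' [NSub (thrice (NV ''r'')) (NConst 1)])))
         (TAnd (TNot (RLess (RCell ''val'' [thrice (NV ''r'')])
                            (RCell ''F'' [NV ''u'', NSub (NV ''r'') (NConst 1)])))
               (NLess (NV ''r'') (NCell ''tau'' [NV ''v'']))))
         (RAssign ''F'' [NV ''u'', NV ''r''] (RCell ''F'' [NV ''u'', NSub (NV ''r'') (NConst 1)]))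
         (RAssign ''F'' [NV ''u'', NV ''r''] (RV ''last'')))"

definition check_com :: com where
  "check_com =
    (Cond (TAnd (TNot (RLess (RCell ''F'' [NV ''u'', NV ''r'']) (RCell ''val'' [NSub (thrice (NV ''r'')) (NConst 1)])))
                (TNot (RLess (RCell ''val'' [thrice (NV ''r'')]) (RCell ''F'' [NV ''u'', NV ''r'']))))
       Skip
       (NAssign ''ok'' [NV ''u''] (NConst 0)) ;;
     RAssign ''w'' [NV ''u'']
       (RAdd (RCell ''w'' [NV ''u''])
         (RAbsPow (RSub (RCell ''F'' [NV ''u'', NV ''r'']) (RCell ''F'' [NV ''u'', NSub (NV ''r'') (NConst 1)])))) ;;
     Cond (TAnd (TNot (RLess (RCell ''F'' [NV ''u'', NV ''r'']) (RConst 0)))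
                (TNot (RLess (RConst 0) (RCell ''F'' [NV ''u'', NV ''r'']))))
       Skip
       (NAssign ''inc'' [NV ''u''] (NAdd (NCell ''inc'' [NV ''u'']) (NConst 1))))"

definition edge_init_com :: com where
  "edge_init_com =
    (Cond (NLess (NConst 0) (NV ''u''))
       (RAssign ''first'' [] (RCell ''val'' [NV ''u'']))
       (RAssign ''first'' [] (RCell ''val'' [NV ''v''])) ;;
     Cond (NLess (NV ''v'') (NV ''M''))
       (RAssign ''last'' [] (RCell ''val'' [NV ''v'']))
       (RAssign ''last'' [] (RV ''first'')) ;;
     NAssign ''e'' [] (NCell ''tau'' [NV ''v'']) ;;
     Cond (NLess (NV ''n'') (NV ''e'')) (NAssign ''e'' [] (NV ''n'')) Skip ;;
     RAssign ''F'' [NV ''u'', NCell ''tau'' [NV ''u'']] (RV ''first'') ;;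
     Cond (NLess (NCell ''tau'' [NV ''u'']) (NCell ''tau'' [NV ''v'']))
       (NAssign ''ok'' [NV ''u''] (NConst 1))
       (NAssign ''ok'' [NV ''u''] (NConst 0)) ;;
     RAssign ''w'' [NV ''u''] (RConst 0) ;;
     NAssign ''inc'' [NV ''u''] (NConst 0))"

definition edge_com :: "real \<Rightarrow> com" where
  "edge_com q = (edge_init_com ;;
    For ''r'' (NAdd (NCell ''tau'' [NV ''u'']) (NConst 1)) (NAdd (NV ''e'') (NConst 1))
      (fill_com q ;; check_com))"

definition edges_com :: "real \<Rightarrow> com" where
  "edges_com q = For ''u'' (NConst 0) (NV ''v'') (edge_com q)"

definition relax_com :: com where
  "relax_com =
    Cond
      (TAnd (NLess (NConst 0) (NCell ''ok'' [NV ''u'']))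
      (TAnd (NLess (NCell ''inc'' [NV ''u'']) (NAdd (NV ''k'') (NConst 1)))
      (TAnd (NLess (NConst 0) (NCell ''P'' [NV ''u'', NSub (NV ''k'') (NCell ''inc'' [NV ''u''])]))
            (TNot (TAnd (NLess (NConst 0) (NV ''pred''))
              (TNot (RLess
                (RAdd (RCell ''V'' [NV ''u'', NSub (NV ''k'') (NCell ''inc'' [NV ''u''])]) (RCell ''w'' [NV ''u'']))
                (RV ''best''))))))))
      (NAssign ''pred'' [] (NAdd (NV ''u'') (NConst 1)) ;;
       RAssign ''best'' []
         (RAdd (RCell ''V'' [NV ''u'', NSub (NV ''k'') (NCell ''inc'' [NV ''u''])]) (RCell ''w'' [NV ''u''])))
      Skip"

definition copy_com :: com where
  "copy_com =
    Cond (NLess (NCell ''tau'' [NSub (NV ''pred'') (NConst 1)]) (NV ''r''))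
      (RAssign ''X'' [NV ''v'', NV ''k'', NV ''r''] (RCell ''F'' [NSub (NV ''pred'') (NConst 1), NV ''r'']))
      (RAssign ''X'' [NV ''v'', NV ''k'', NV ''r'']
        (RCell ''X'' [NSub (NV ''pred'') (NConst 1),
          NSub (NV ''k'') (NCell ''inc'' [NSub (NV ''pred'') (NConst 1)]), NV ''r'']))"

definition cell_com :: com where
  "cell_com =
    ((NAssign ''pred'' [] (NConst 0) ;; RAssign ''best'' [] (RConst 0)) ;;
     For ''u'' (NConst 0) (NV ''v'') relax_com ;;
     (NAssign ''P'' [NV ''v'', NV ''k''] (NV ''pred'') ;;
      RAssign ''V'' [NV ''v'', NV ''k''] (RV ''best'')) ;;
     For ''r'' (NConst 1) (NAdd (NV ''n'') (NConst 1)) copy_com)"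

definition dp_com :: "real \<Rightarrow> com" where
  "dp_com q =
    (For ''k'' (NConst 0) (NAdd (NV ''n'') (NConst 1))
       (NAssign ''P'' [NConst 0, NV ''k''] (NConst 1) ;; RAssign ''V'' [NConst 0, NV ''k''] (RConst 0)) ;;
     For ''v'' (NConst 1) (NAdd (NV ''M'') (NConst 1))
       (edges_com q ;; For ''k'' (NConst 0) (NAdd (NV ''n'') (NConst 1)) cell_com))"

text \<open>
  A bound \<open>k\<close> that no sequence attains is filled with the centre \<open>m\<close> of the tube, so that
  every list has \<open>n + 1\<close> feasible entries.
\<close>

definition output_com :: com where
  "output_com =
    (For ''k'' (NConst 0) (NAdd (NV ''n'') (NConst 1))
       (For ''r'' (NConst 1) (NAdd (NV ''n'') (NConst 1))
         (Cond (NLess (NConst 0) (NCell ''P'' [NV ''M'', NV ''k'']))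
           (RAssign ''theta'' [NV ''i'', NV ''k'', NSub (NV ''r'') (NConst 1)]
             (RCell ''X'' [NV ''M'', NV ''k'', NV ''r'']))
           (RAssign ''theta'' [NV ''i'', NV ''k'', NSub (NV ''r'') (NConst 1)]
             (RCell ''m'' [NSub (NV ''r'') (NConst 1), NV ''i''])))) ;;
     NAssign ''count'' [NV ''i''] (NAdd (NV ''n'') (NConst 1)))"

definition coord_com :: "real \<Rightarrow> com" where
  "coord_com q = (nodes_com ;; dp_com q ;; output_com)"

definition path_com :: "real \<Rightarrow> com" where
  "path_com q =
    ((NAssign ''n'' [] (NAdd (NV ''T'') (NConst 1)) ;;
      NAssign ''M'' [] (NAdd (thrice (NV ''n'')) (NConst 1))) ;;
     For ''i'' (NConst 1) (NAdd (NV ''p'') (NConst 1)) (coord_com q))"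

lemma writes_node_com [simp]: "writes node_com = {''c'', ''rn'', ''tau'', ''val''}"
  by (auto simp: node_com_def)

lemma writes_nodes_com [simp]: "writes nodes_com = {''c'', ''t'', ''rn'', ''tau'', ''val''}"
  by (auto simp: nodes_com_def)

lemma writes_fill_com [simp]: "writes (fill_com q) = {''F''}"
  by (simp add: fill_com_def)

lemma writes_check_com [simp]: "writes check_com = {''ok'', ''w'', ''inc''}"
  by (auto simp: check_com_def)

lemma writes_edge_init_com [simp]:
  "writes edge_init_com = {''first'', ''last'', ''e'', ''F'', ''ok'', ''w'', ''inc''}"
  by (auto simp: edge_init_com_def)

lemma writes_edge_com [simp]: "writes (edge_com q) = {''first'', ''last'', ''e'', ''F'', ''ok'', ''w'', ''inc'', ''r''}"
  by (auto simp: edge_com_def edge_init_com_def fill_com_def check_com_def)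

lemma writes_edges_com [simp]: "writes (edges_com q) = insert ''u'' (writes (edge_com q))"
  by (simp add: edges_com_def)

lemma writes_relax_com [simp]: "writes relax_com = {''pred'', ''best''}"
  by (auto simp: relax_com_def)

lemma writes_copy_com [simp]: "writes copy_com = {''X''}"
  by (auto simp: copy_com_def)

lemma writes_cell_com [simp]: "writes cell_com = {''pred'', ''best'', ''u'', ''P'', ''V'', ''r'', ''X''}"
  by (auto simp: cell_com_def writes_relax_com writes_copy_com)

lemma writes_dp_com [simp]: "writes (dp_com q) = {''k'', ''P'', ''V'', ''v'', ''u'', ''pred'', ''best'', ''r'', ''X'',
    ''first'', ''last'', ''e'', ''F'', ''ok'', ''w'', ''inc''}"
  by (auto simp: dp_com_def writes_edges_com writes_edge_com writes_cell_com)

lemma writes_output_com [simp]: "writes output_com = {''k'', ''r'', ''theta'', ''count''}"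
  by (auto simp: output_com_def)

lemma writes_coord_com [simp]: "writes (coord_com q) = {''k'', ''P'', ''V'', ''v'', ''u'', ''pred'', ''best'', ''r'', ''X'',
    ''first'', ''last'', ''e'', ''F'', ''ok'', ''w'', ''inc'', ''c'', ''t'', ''rn'', ''tau'', ''val'', ''theta'', ''count''}"
  by (auto simp: coord_com_def writes_nodes_com writes_dp_com writes_output_com)

section \<open>Nodes and edges\<close>

lemma tau_eq_iff: "tau u = k \<longleftrightarrow> u = 3 * k - 2 \<or> u = 3 * k - 1 \<or> u = 3 * k"
  unfolding tau_def by auto

lemma node_val_3: "1 \<le> k \<Longrightarrow> node_val a b (3 * k - 2) = 0"
  "1 \<le> k \<Longrightarrow> node_val a b (3 * k - 1) = a k"
  "node_val a b (3 * k) = b k"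
proof -
  have "tau (3 * k) = k"
    by (simp add: tau_eq_iff)
  then show "node_val a b (3 * k) = b k"
    by (simp add: node_val_def)
  assume "1 \<le> k"
  then obtain k' where k: "k = Suc k'"
    by (cases k) auto
  have "(3 * k' + 1) mod 3 = 1" "(3 * k' + 2) mod 3 = 2" "tau (3 * k' + 2) = k"
    by (presburger, presburger, simp add: tau_eq_iff k)
  then show "node_val a b (3 * k - 2) = 0" "node_val a b (3 * k - 1) = a k"
    by (simp_all add: node_val_def k)
qed

context tube
begin

definition nodes_ok :: "store \<Rightarrow> bool" where
  "nodes_ok s \<longleftrightarrow> nats s (''n'', []) = n \<and> nats s (''M'', []) = sink \<and>
     (\<forall>u. tau u \<le> Suc n \<longrightarrow> nats s (''tau'', [u]) = tau u \<and> reals s (''val'', [u]) = val u) \<and>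
     (\<forall>t\<le>Suc n. reals s (''rn'', [t]) = real t)"

lemma nodes_com_correct:
  assumes "nats s (''n'', []) = n" "nats s (''M'', []) = sink"
    and a: "\<And>t. a t = reals s (''m'', [t - 1, nats s (''i'', [])]) - reals s (''lambda'', [t - 1])"
    and b: "\<And>t. b t = reals s (''m'', [t - 1, nats s (''i'', [])]) + reals s (''lambda'', [t - 1])"
  shows "runs q nodes_com s (500 * n) nodes_ok"
proof -
  define I where "I k s' \<longleftrightarrow> reals s' (''c'', []) = real k \<and>
    (\<forall>t<k. reals s' (''rn'', [t]) = real t) \<and>
    (\<forall>u. tau u < k \<longrightarrow> nats s' (''tau'', [u]) = tau u \<and> reals s' (''val'', [u]) = val u)"
    for k :: nat and s' :: store
  have step: "runs q node_com s' 91 (\<lambda>s''. Z s'' \<longrightarrow> I (Suc k) (set_nat s'' ''t'' (Suc k)))"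
    if so: "same_outside (insert ''t'' (writes node_com)) s1 s'" "same_outside {''c''} s s1"
      and t: "nats s' (''t'', []) = k" and I: "I k s'" for k s1 s' Z
  proof -
    note same = so[THEN same_outside_nats] so[THEN same_outside_reals]
    have ab: "reals s' (''m'', [k - Suc 0, nats s' (''i'', [])]) - reals s' (''lambda'', [k - Suc 0]) = a k"
      "reals s' (''m'', [k - Suc 0, nats s' (''i'', [])]) + reals s' (''lambda'', [k - Suc 0]) = b k"
      using a[of k] b[of k] by (simp_all add: same)
    have disj: "u \<noteq> 3 * k - 2" "u \<noteq> 3 * k - Suc 0" "u \<noteq> 3 * k" if "tau u < k" for u
      using that tau_eq_iff[of u k] by auto
    have Ik: "nats s' (''tau'', [u]) = tau u" "reals s' (''val'', [u]) = val u" if "tau u < k" for u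
      using I that by (simp_all add: I_def)
    have cases: "tau u < k \<or> (u = 0 \<and> k = 0 \<and> val 0 = b 0) \<or> (\<exists>k'. k = Suc k' \<and> tau u = k \<and>
        (u = 3 * k' + 1 \<and> val u = 0 \<or> u = 3 * k' + 2 \<and> val u = a k \<or> u = 3 * k' + 3 \<and> val u = b k))"
      if "tau u < Suc k" for u
    proof (cases "tau u = k")
      case True
      then show ?thesis
        using node_val_3[where k = k and a = a and b = b] tau_eq_iff[of u k] by (cases k) auto
    qed (use that in simp)
    show ?thesis
      unfolding node_com_def
      apply (simp add: t ab)
      apply (unfold I_def)
      apply (intro impI conjI allI)
      subgoal using I by (simp add: I_def)
      subgoal using I by (auto simp: I_def less_Suc_eq)
      subgoal for u
        apply (cases "tau u < k")
        subgoal using disj[of u] Ik[of u] by simp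
        subgoal by (drule cases) (elim disjE exE conjE; simp)
        done
      subgoal for u
        apply (cases "tau u < k")
        subgoal using disj[of u] Ik[of u] by simp
        subgoal by (drule cases) (elim disjE exE conjE; simp)
        done
      done
  qed
  have "runs q (For ''t'' (NConst 0) (NAdd (NV ''n'') (NConst 2)) node_com) s1 (100 * n + 220) nodes_ok"
    if s1: "same_outside {''c''} s s1 \<and> reals s1 (''c'', []) = 0" for s1
  proof (rule runs_For[where L = 0 and H = "n + 2" and I = I and B = 91])
    show "nval s' (NAdd (NV ''n'') (NConst 2)) = n + 2"
      if "same_outside (insert ''t'' (writes node_com)) s1 s'" for s'
      using that s1 assms(1) by (simp add: same_outside_def)
    show "I 0 (set_nat s1 ''t'' 0)"
      using s1 by (simp add: I_def)
    show "nodes_ok s'" if "same_outside (insert ''t'' (writes node_com)) s1 s'" "I (n + 2) s'" for s'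
      using that s1 assms(1,2) by (auto simp: nodes_ok_def I_def same_outside_def less_Suc_eq_le)
    show "(n + 2 - 0) * (91 + ncost (NAdd (NV ''n'') (NConst 2)) + 6) + ncost (NConst 0) +
        ncost (NAdd (NV ''n'') (NConst 2)) + 3 \<le> 100 * n + 220"
      by simp
  qed (use s1 in \<open>auto intro: step\<close>)
  note loop = this
  have init: "runs q (RAssign ''c'' [] (RConst 0)) s 10
      (\<lambda>s1. same_outside {''c''} s s1 \<and> reals s1 (''c'', []) = 0)"
    by (simp add: same_outside_def)
  show ?thesis
    unfolding nodes_com_def by (rule runs_Sequ[OF init loop]) (use n in simp_all)
qed

lemma nodes_okD:
  assumes "nodes_ok s"
  shows "nats s (''n'', []) = n" "nats s (''M'', []) = sink"
    "\<And>u. tau u \<le> Suc n \<Longrightarrow> nats s (''tau'', [u]) = tau u"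
    "\<And>u. tau u \<le> Suc n \<Longrightarrow> reals s (''val'', [u]) = val u"
    "\<And>t. t \<le> Suc n \<Longrightarrow> reals s (''rn'', [t]) = real t"
  using assms by (simp_all add: nodes_ok_def)

lemma nodes_ok_bounds:
  assumes "nodes_ok s" "1 \<le> r" "r \<le> n"
  shows "reals s (''val'', [3 * r - Suc 0]) = a r" "reals s (''val'', [3 * r]) = b r"
proof -
  have "tau (3 * r - 1) = r" "tau (3 * r) = r"
    using assms(2) tau_eq_iff by blast+
  then show "reals s (''val'', [3 * r - Suc 0]) = a r" "reals s (''val'', [3 * r]) = b r"
    using nodes_okD(4)[OF assms(1)] node_val_3[where k = r and a = a and b = b] assms(2,3) by simp_all
qed

lemma nodes_ok_same:
  assumes "nodes_ok s" "same_outside W s s'" "{''n'', ''M'', ''tau'', ''val'', ''rn''} \<inter> W = {}"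
  shows "nodes_ok s'"
  using assms by (simp add: nodes_ok_def same_outside_def)

definition edge_done :: "store \<Rightarrow> nat \<Rightarrow> nat \<Rightarrow> bool" where
  "edge_done s u v \<longleftrightarrow> nats s (''ok'', [u]) = of_bool (edge u v) \<and>
     reals s (''w'', [u]) = edge_var u v \<and> nats s (''inc'', [u]) = edge_supp u v \<and>
     (\<forall>r\<in>{tau u<..end_time v}. reals s (''F'', [u, r]) = fill u v r)"

definition same_edge :: "store \<Rightarrow> store \<Rightarrow> nat \<Rightarrow> bool" where
  "same_edge s s' u \<longleftrightarrow> nats s' (''ok'', [u]) = nats s (''ok'', [u]) \<and>
     reals s' (''w'', [u]) = reals s (''w'', [u]) \<and> nats s' (''inc'', [u]) = nats s (''inc'', [u]) \<and>
     (\<forall>r. reals s' (''F'', [u, r]) = reals s (''F'', [u, r]))"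

lemma edge_done_same: "edge_done s u v \<Longrightarrow> same_edge s s' u \<Longrightarrow> edge_done s' u v"
  by (simp add: edge_done_def same_edge_def)

text \<open>
  What the body of the loop over the entries of an edge may rely on and does not change.
\<close>

definition edge_state :: "store \<Rightarrow> nat \<Rightarrow> nat \<Rightarrow> bool" where
  "edge_state s u v \<longleftrightarrow> nodes_ok s \<and> nats s (''u'', []) = u \<and> nats s (''v'', []) = v \<and>
     reals s (''first'', []) = first_val u v \<and> reals s (''last'', []) = last_val u v \<and>
     nats s (''e'', []) = end_time v"

lemma edge_state_same:
  assumes "edge_state s u v" "same_outside W s s'"
    "{''n'', ''M'', ''tau'', ''val'', ''rn'', ''u'', ''v'', ''first'', ''last'', ''e''} \<inter> W = {}"
  shows "edge_state s' u v"
  using assms nodes_ok_same[OF _ assms(2)] by (simp add: edge_state_def same_outside_def)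

lemma fill_com_correct:
  assumes s: "edge_state s u v" "nats s (''r'', []) = r"
    and uv: "tau u \<le> n" "tau v \<le> Suc n" and r: "tau u < r" "r \<le> n"
    and F: "reals s (''F'', [u, r - 1]) = fill u v (r - 1)"
  shows "runs q (fill_com q) s 60 (\<lambda>s'. s' = s\<lparr>reals := (reals s)((''F'', [u, r]) := fill u v r)\<rparr>)"
proof -
  have nodes: "nodes_ok s"
    using s(1) by (simp add: edge_state_def)
  note vals = nodes_okD[OF nodes] nodes_ok_bounds[OF nodes, of r]
  show ?thesis
  proof (cases "1 \<le> q")
    case True
    then show ?thesis
      using s uv r vals fill_line[OF True, of u r v]
      unfolding fill_com_def if_P[OF True] by (simp add: edge_state_def)
  next
    case False
    show ?thesis
      using s uv r vals F fill_stay[OF False r(1), of v]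
      unfolding fill_com_def if_not_P[OF False] by (simp add: edge_state_def not_less)
  qed
qed

lemma edge_init_com_correct:
  assumes "nodes_ok s" "nats s (''u'', []) = u" "nats s (''v'', []) = v" "u < v" "v \<le> sink"
  shows "runs q edge_init_com s 80 (\<lambda>s'. edge_state s' u v \<and>
     reals s' (''F'', [u, tau u]) = first_val u v \<and> nats s' (''ok'', [u]) = of_bool (tau u < tau v) \<and>
     reals s' (''w'', [u]) = 0 \<and> nats s' (''inc'', [u]) = 0 \<and>
     (\<forall>u'. u' \<noteq> u \<longrightarrow> same_edge s s' u'))"
proof (rule runs_frame)
  have "tau v \<le> Suc n" "tau u \<le> Suc n"
    using tau_mono[of v sink] tau_mono[of u sink] assms by auto
  moreover have "nodes_ok s'" if "same_outside (writes edge_init_com) s s'" for s'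
    using nodes_ok_same[OF assms(1) that] by (simp add: edge_init_com_def)
  ultimately show "runs q edge_init_com s 80 (\<lambda>s'. same_outside (writes edge_init_com) s s' \<longrightarrow>
     edge_state s' u v \<and>
     reals s' (''F'', [u, tau u]) = first_val u v \<and> nats s' (''ok'', [u]) = of_bool (tau u < tau v) \<and>
     reals s' (''w'', [u]) = 0 \<and> nats s' (''inc'', [u]) = 0 \<and>
     (\<forall>u'. u' \<noteq> u \<longrightarrow> same_edge s s' u'))"
    using nodes_okD[OF assms(1)] assms(2-5) unfolding edge_init_com_def
    by (simp add: edge_state_def same_edge_def first_val_def last_val_def end_time_def min_def not_less del: writes.simps)
qed

lemma edge_step_correct:
  assumes s: "edge_state s u v" "nats s (''r'', []) = Suc k"
    and uv: "tau u \<le> n" "tau v \<le> Suc n" and k: "tau u \<le> k" "Suc k \<le> n"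
    and F: "reals s (''F'', [u, k]) = fill u v k"
  shows "runs q (fill_com q ;; check_com) s 140 (\<lambda>s'.
     reals s' (''F'', [u, Suc k]) = fill u v (Suc k) \<and>
     (\<forall>r. r \<noteq> Suc k \<longrightarrow> reals s' (''F'', [u, r]) = reals s (''F'', [u, r])) \<and>
     reals s' (''w'', [u]) = reals s (''w'', [u]) + abs_pow q (fill u v (Suc k) - fill u v k) \<and>
     nats s' (''inc'', [u]) = nats s (''inc'', [u]) + of_bool (fill u v (Suc k) \<noteq> 0) \<and>
     nats s' (''ok'', [u]) = (if a (Suc k) \<le> fill u v (Suc k) \<and> fill u v (Suc k) \<le> b (Suc k)
       then nats s (''ok'', [u]) else 0) \<and>
     (\<forall>u'. u' \<noteq> u \<longrightarrow> same_edge s s' u'))"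
    (is "runs q _ s 140 ?Q")
proof -
  have fill: "runs q (fill_com q) s 60 (\<lambda>s'. s' = s\<lparr>reals := (reals s)((''F'', [u, Suc k]) := fill u v (Suc k))\<rparr>)"
    using assms by (intro fill_com_correct) auto
  have nodes: "nodes_ok s"
    using s(1) by (simp add: edge_state_def)
  note vals = nodes_ok_bounds[OF nodes, of "Suc k"]
  have "runs q check_com (s\<lparr>reals := (reals s)((''F'', [u, Suc k]) := fill u v (Suc k))\<rparr>) 80 ?Q"
    using s k F vals unfolding check_com_def
    by (auto simp: edge_state_def same_edge_def)
  then show ?thesis
    by (intro runs_Sequ[OF fill]) auto
qed

lemma edge_com_correct:
  assumes "nodes_ok s" "nats s (''u'', []) = u" "nats s (''v'', []) = v" "u < v" "v \<le> sink"
  shows "runs q (edge_com q) s (400 * n) (\<lambda>s'. edge_done s' u v \<and> (\<forall>u'. u' \<noteq> u \<longrightarrow> same_edge s s' u'))"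
proof -
  have tau: "tau v \<le> Suc n" "tau u \<le> n" "tau u \<le> end_time v"
    using tau_mono[of v sink] tau_mono[of u v] tau_le_n_iff[of u] assms by (auto simp: end_time_def)
  define I where "I k s' \<longleftrightarrow>
     (\<forall>r\<in>{tau u..<k}. reals s' (''F'', [u, r]) = fill u v r) \<and>
     nats s' (''ok'', [u]) = of_bool (tau u < tau v \<and>
       (\<forall>r\<in>{tau u<..<k}. a r \<le> fill u v r \<and> fill u v r \<le> b r)) \<and>
     reals s' (''w'', [u]) = var (fill u v) (tau u) (k - 1) \<and>
     nats s' (''inc'', [u]) = supp (fill u v) (tau u) (k - 1) \<and>
     (\<forall>u'. u' \<noteq> u \<longrightarrow> same_edge s s' u')" for k s'
  let ?body = "fill_com q ;; check_com"
  have step: "runs q ?body s' 140 (\<lambda>s''. Z s'' \<longrightarrow> I (Suc k) (set_nat s'' ''r'' (Suc k)))"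
    if k: "Suc (tau u) \<le> k" "k < Suc (end_time v)" "nats s' (''r'', []) = k"
      and s': "edge_state s' u v" and I: "I k s'" for k s' Z
  proof -
    obtain j where j: "k = Suc j" "tau u \<le> j"
      using k(1) by (cases k) auto
    have "Suc j \<le> n"
      using k j by (simp add: end_time_def)
    moreover have "reals s' (''F'', [u, j]) = fill u v j"
      using I j by (simp add: I_def)
    ultimately have "runs q ?body s' 140 (\<lambda>s''.
       reals s'' (''F'', [u, Suc j]) = fill u v (Suc j) \<and>
       (\<forall>r. r \<noteq> Suc j \<longrightarrow> reals s'' (''F'', [u, r]) = reals s' (''F'', [u, r])) \<and>
       reals s'' (''w'', [u]) = reals s' (''w'', [u]) + abs_pow q (fill u v (Suc j) - fill u v j) \<and>
       nats s'' (''inc'', [u]) = nats s' (''inc'', [u]) + of_bool (fill u v (Suc j) \<noteq> 0) \<and>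
       nats s'' (''ok'', [u]) = (if a (Suc j) \<le> fill u v (Suc j) \<and> fill u v (Suc j) \<le> b (Suc j)
         then nats s' (''ok'', [u]) else 0) \<and>
       (\<forall>u'. u' \<noteq> u \<longrightarrow> same_edge s' s'' u'))"
      using s' j k(3) tau by (intro edge_step_correct) auto
    then show ?thesis
    proof (rule runs_mono[OF _ order_refl], intro impI, elim conjE)
      fix s''
      assume s'': "reals s'' (''F'', [u, Suc j]) = fill u v (Suc j)"
       "\<forall>r. r \<noteq> Suc j \<longrightarrow> reals s'' (''F'', [u, r]) = reals s' (''F'', [u, r])"
       "reals s'' (''w'', [u]) = reals s' (''w'', [u]) + abs_pow q (fill u v (Suc j) - fill u v j)"
       "nats s'' (''inc'', [u]) = nats s' (''inc'', [u]) + of_bool (fill u v (Suc j) \<noteq> 0)"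
       "nats s'' (''ok'', [u]) = (if a (Suc j) \<le> fill u v (Suc j) \<and> fill u v (Suc j) \<le> b (Suc j)
         then nats s' (''ok'', [u]) else 0)"
       "\<forall>u'. u' \<noteq> u \<longrightarrow> same_edge s' s'' u'"
      have 1: "\<forall>r\<in>{tau u..<Suc k}. reals s'' (''F'', [u, r]) = fill u v r"
        using I s''(1,2) j(1) by (auto simp: I_def less_Suc_eq)
      have "{tau u<..<Suc k} = insert k {tau u<..<k}"
        using k(1) by auto
      then have 2: "nats s'' (''ok'', [u]) = of_bool (tau u < tau v \<and>
       (\<forall>r\<in>{tau u<..<Suc k}. a r \<le> fill u v r \<and> fill u v r \<le> b r))"
        using I s''(5) j(1) by (auto simp: I_def)
      have 3: "reals s'' (''w'', [u]) = var (fill u v) (tau u) k"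
        using I s''(3) j by (simp add: I_def var_Suc)
      have 4: "nats s'' (''inc'', [u]) = supp (fill u v) (tau u) k"
        using I s''(4) j by (simp add: I_def supp_Suc)
      have 5: "\<forall>u'. u' \<noteq> u \<longrightarrow> same_edge s s'' u'"
        using I s''(6) by (simp add: I_def same_edge_def)
      show "I (Suc k) (set_nat s'' ''r'' (Suc k))"
        using 1 2 3 4 5 by (simp add: I_def same_edge_def)
    qed
  qed
  have loop: "runs q (For ''r'' (NAdd (NCell ''tau'' [NV ''u'']) (NConst 1)) (NAdd (NV ''e'') (NConst 1)) ?body)
      s1 (149 * n + 20) (\<lambda>s'. edge_done s' u v \<and> (\<forall>u'. u' \<noteq> u \<longrightarrow> same_edge s s' u'))"
    if s1: "edge_state s1 u v \<and>
     reals s1 (''F'', [u, tau u]) = first_val u v \<and> nats s1 (''ok'', [u]) = of_bool (tau u < tau v) \<and>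
     reals s1 (''w'', [u]) = 0 \<and> nats s1 (''inc'', [u]) = 0 \<and>
     (\<forall>u'. u' \<noteq> u \<longrightarrow> same_edge s s1 u')" for s1
  proof (rule runs_For[where L = "Suc (tau u)" and H = "Suc (end_time v)" and I = I and B = 140])
    have nodes: "nodes_ok s1"
      using s1 by (simp add: edge_state_def)
    show "nval s1 (NAdd (NCell ''tau'' [NV ''u'']) (NConst 1)) = Suc (tau u)"
      using s1 nodes_okD(3)[OF nodes, of u] tau(2) by (simp add: edge_state_def)
    show "nval s' (NAdd (NV ''e'') (NConst 1)) = Suc (end_time v)"
      if "same_outside (insert ''r'' (writes ?body)) s1 s'" for s'
      using that s1 by (simp add: same_outside_def edge_state_def)
    show "I (Suc (tau u)) (set_nat s1 ''r'' (Suc (tau u)))"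
      using s1 by (auto simp: I_def same_edge_def fill_before var_def supp_def)
    show "edge_done s' u v \<and> (\<forall>u'. u' \<noteq> u \<longrightarrow> same_edge s s' u')" if "I (Suc (end_time v)) s'" for s'
      using that by (auto simp: I_def edge_done_def edge_def less_Suc_eq_le)
    show "runs q ?body s' 140 (\<lambda>s''. same_outside (writes ?body) s' s'' \<longrightarrow>
        I (Suc k) (set_nat s'' ''r'' (Suc k)))"
      if "Suc (tau u) \<le> k" "k < Suc (end_time v)" "nats s' (''r'', []) = k"
        "same_outside (insert ''r'' (writes ?body)) s1 s'" "I k s'" for k s'
      using that s1 edge_state_same[of s1 u v _ s'] by (intro step) auto
    have "Suc (end_time v) - Suc (tau u) \<le> n"
      by (simp add: end_time_def)
    then have "(Suc (end_time v) - Suc (tau u)) * 149 \<le> n * 149"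
      by (rule mult_le_mono1)
    then show "(Suc (end_time v) - Suc (tau u)) * (140 + ncost (NAdd (NV ''e'') (NConst 1)) + 6) +
        ncost (NAdd (NCell ''tau'' [NV ''u'']) (NConst 1)) + ncost (NAdd (NV ''e'') (NConst 1)) + 3
        \<le> 149 * n + 20"
      by simp
  qed (use tau in auto)
  show ?thesis
    unfolding edge_com_def
    by (rule runs_Sequ[OF edge_init_com_correct[OF assms] loop]) (use n in simp_all)
qed

end

section \<open>The dynamic program\<close>

context tube
begin

lemma edges_com_correct:
  assumes s: "nodes_ok s" "nats s (''v'', []) = v" and v: "v \<le> sink"
  shows "runs q (edges_com q) s (1700 * n^2) (\<lambda>s'. \<forall>u<v. edge_done s' u v)"
  unfolding edges_com_def
proof (rule runs_For[where L = 0 and H = v and I = "\<lambda>k s'. \<forall>u<k. edge_done s' u v" and B = "400 * n"])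
  fix k s'
  assume k: "k < v" "nats s' (''u'', []) = k"
    and so: "same_outside (insert ''u'' (writes (edge_com q))) s s'" and I: "\<forall>u<k. edge_done s' u v"
  have "runs q (edge_com q) s' (400 * n) (\<lambda>s''. edge_done s'' k v \<and> (\<forall>u'. u' \<noteq> k \<longrightarrow> same_edge s' s'' u'))"
  proof (rule edge_com_correct)
    show "nodes_ok s'"
      by (rule nodes_ok_same[OF s(1) so]) simp
    show "nats s' (''v'', []) = v"
      using same_outside_nats[OF so, of "''v''" "[]"] s(2) by simp
  qed (use k v in auto)
  then show "runs q (edge_com q) s' (400 * n) (\<lambda>s''. same_outside (writes (edge_com q)) s' s'' \<longrightarrow>
      (\<forall>u<Suc k. edge_done (set_nat s'' ''u'' (Suc k)) u v))"
  proof (rule runs_mono[OF _ order_refl], intro impI allI)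
    fix s'' u
    assume "edge_done s'' k v \<and> (\<forall>u'. u' \<noteq> k \<longrightarrow> same_edge s' s'' u')" "u < Suc k"
    then have "edge_done s'' u v"
      using I edge_done_same[of s' u v s''] by (cases "u = k") auto
    then show "edge_done (set_nat s'' ''u'' (Suc k)) u v"
      by (simp add: edge_done_def)
  qed
next
  have "v * (7 + 400 * n) \<le> (4 * n) * (407 * n)"
    using v n by (intro mult_mono) auto
  then have "v * (7 + 400 * n) \<le> 1628 * n^2"
    by (simp add: power2_eq_square)
  moreover have "1 \<le> n^2"
    using n by simp
  ultimately have "v * (7 + 400 * n) + 5 \<le> 1700 * n^2"
    by linarith
  then show "(v - 0) * (400 * n + ncost (NV ''v'') + 6) + ncost (NConst 0) + ncost (NV ''v'') + 3 \<le> 1700 * n^2"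
    by (simp add: algebra_simps)
qed (use s in \<open>auto simp: same_outside_def\<close>)

text \<open>
  Soundness of a table entry: \<open>x\<close> is feasible up to node \<open>v\<close> and its support and variation
  are at most the recorded values. The last conjunct links \<open>x\<close> to the next edge, whose first
  difference is taken from the value of \<open>v\<close>.
\<close>

definition prefix_ok :: "nat \<Rightarrow> nat \<Rightarrow> (nat \<Rightarrow> real) \<Rightarrow> real \<Rightarrow> bool" where
  "prefix_ok v k x c \<longleftrightarrow> (\<forall>r\<in>{1..end_time v}. a r \<le> x r \<and> x r \<le> b r) \<and>
     supp x 0 (end_time v) \<le> k \<and> var x 1 (end_time v) \<le> c \<and>
     (0 < v \<and> v < sink \<longrightarrow> x (tau v) = val v)"

text \<open>
  The variation is counted from time 1 in a prefix but from \<open>tau u\<close> in an edge. For an edge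
  that leaves the source this includes a difference at time 1, which is harmless since it is
  nonnegative.
\<close>

lemma prefix_extend:
  assumes x: "prefix_ok u j x c" and uv: "edge u v" "v \<le> sink"
    and y: "\<And>r. 1 \<le> r \<Longrightarrow> r \<le> end_time v \<Longrightarrow> y r = (if tau u < r then fill u v r else x r)"
  shows "prefix_ok v (j + edge_supp u v) y (c + edge_var u v)"
proof -
  let ?e = "end_time v"
  have tau: "tau u < tau v"
    using uv(1) by (simp add: edge_def)
  have "tau v \<le> Suc n"
    using tau_mono[OF uv(2)] by simp
  then have e: "end_time u = tau u" "tau u \<le> ?e"
    using tau by (auto simp: end_time_def)
  have v_pos: "0 < v"
    using tau_less_imp_less[OF tau] by simp
  have u_lt: "u < sink"
    using tau_less_imp_less[OF tau] uv(2) by simp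
  have "a r \<le> y r \<and> y r \<le> b r" if "r \<in> {1..?e}" for r
    using that y[of r] x uv(1) e by (auto simp: prefix_ok_def edge_def)
  moreover have "supp y 0 ?e \<le> j + edge_supp u v"
  proof -
    have "supp y 0 (tau u) = supp x 0 (tau u)" "supp y (tau u) ?e = edge_supp u v"
      using y e by (intro supp_cong; simp)+
    then show ?thesis
      using supp_split[of 0 "tau u" ?e y] e x by (simp add: prefix_ok_def)
  qed
  moreover have "var y 1 ?e \<le> c + edge_var u v"
  proof (cases "u = 0")
    case True
    have "var y 1 ?e = var (fill u v) 1 ?e"
      using y True by (intro var_cong) auto
    moreover have "0 \<le> c"
      using x var_nonneg[of x 1 "end_time u"] by (simp add: prefix_ok_def)
    ultimately show ?thesis
      using var_le_var_0[of "fill u v" ?e] True by simp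
  next
    case False
    have t1: "1 \<le> tau u"
      using max_tau_1[OF False] by simp
    have "var y 1 (tau u) = var x 1 (tau u)"
      using y e by (intro var_cong) auto
    moreover have "var y (tau u) ?e = edge_var u v"
    proof (rule var_cong)
      fix r assume r: "tau u \<le> r" "r \<le> ?e"
      show "y r = fill u v r"
      proof (cases "r = tau u")
        case True
        then show ?thesis
          using y[of r] r t1 False x u_lt by (simp add: fill_before first_val_def prefix_ok_def)
      qed (use y[of r] r t1 in simp)
    qed
    ultimately show ?thesis
      using var_split[of 1 "tau u" ?e y] t1 e x by (simp add: prefix_ok_def)
  qed
  moreover have "y (tau v) = val v" if "v < sink"
  proof -
    have "?e = tau v"
      using that tau_le_n_iff[of v] by (simp add: end_time_def)
    then show ?thesis
      using y[of "tau v"] tau that by (simp add: fill_end last_val_def)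
  qed
  ultimately show ?thesis
    by (simp add: prefix_ok_def)
qed

text \<open>
  Soundness and completeness of the table entry \<open>(v, k)\<close>: its sequence is as good as
  recorded, and the record is as good as any walk. Optimality of the output follows by
  comparison with the walk that dominates an arbitrary feasible sequence.
\<close>

definition cell_ok :: "store \<Rightarrow> nat \<Rightarrow> nat \<Rightarrow> bool" where
  "cell_ok s v k \<longleftrightarrow>
     (nats s (''P'', [v, k]) \<noteq> 0 \<longrightarrow>
        prefix_ok v k (\<lambda>r. reals s (''X'', [v, k, r])) (reals s (''V'', [v, k]))) \<and>
     (\<forall>c. walk v k c \<longrightarrow> nats s (''P'', [v, k]) \<noteq> 0 \<and> reals s (''V'', [v, k]) \<le> c)"

definition same_cell :: "store \<Rightarrow> store \<Rightarrow> nat \<Rightarrow> nat \<Rightarrow> bool" where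
  "same_cell s s' v k \<longleftrightarrow> nats s' (''P'', [v, k]) = nats s (''P'', [v, k]) \<and>
     reals s' (''V'', [v, k]) = reals s (''V'', [v, k]) \<and>
     (\<forall>r. reals s' (''X'', [v, k, r]) = reals s (''X'', [v, k, r]))"

lemma cell_ok_same: "cell_ok s v k \<Longrightarrow> same_cell s s' v k \<Longrightarrow> cell_ok s' v k"
  by (simp add: cell_ok_def same_cell_def)

text \<open>
  \<open>u\<close> can precede \<open>v\<close> on a walk with at most \<open>k\<close> nonzero entries, as far as the table \<open>s\<close>
  knows.
\<close>

definition cand :: "store \<Rightarrow> nat \<Rightarrow> nat \<Rightarrow> nat \<Rightarrow> bool" where
  "cand s v k u \<longleftrightarrow> edge u v \<and> edge_supp u v \<le> k \<and> nats s (''P'', [u, k - edge_supp u v]) \<noteq> 0"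

definition cand_var :: "store \<Rightarrow> nat \<Rightarrow> nat \<Rightarrow> nat \<Rightarrow> real" where
  "cand_var s v k u = reals s (''V'', [u, k - edge_supp u v]) + edge_var u v"

lemma relax_com_correct:
  assumes "nats s (''u'', []) = u" "nats s (''k'', []) = k" "edge_done s u v"
  shows "runs q relax_com s 80 (\<lambda>s'.
    if cand s v k u \<and> (nats s (''pred'', []) = 0 \<or> cand_var s v k u < reals s (''best'', []))
    then nats s' (''pred'', []) = Suc u \<and> reals s' (''best'', []) = cand_var s v k u
    else nats s' (''pred'', []) = nats s (''pred'', []) \<and> reals s' (''best'', []) = reals s (''best'', []))"
  using assms unfolding relax_com_def
  by (auto simp: edge_done_def cand_def cand_var_def less_Suc_eq_le)

text \<open>
  \<open>p\<close> and \<open>c\<close> are the running result of the search for the best predecessor among the nodes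
  below \<open>l\<close>; \<open>p\<close> is shifted by one as in the array \<open>P\<close>.
\<close>

definition best_cand :: "store \<Rightarrow> nat \<Rightarrow> nat \<Rightarrow> nat \<Rightarrow> nat \<Rightarrow> real \<Rightarrow> bool" where
  "best_cand s v k l p c \<longleftrightarrow>
     (p \<noteq> 0 \<longrightarrow> p - 1 < l \<and> cand s v k (p - 1) \<and> c = cand_var s v k (p - 1)) \<and>
     (\<forall>u<l. cand s v k u \<longrightarrow> p \<noteq> 0 \<and> c \<le> cand_var s v k u)"

lemma relax_loop_correct:
  assumes s: "nats s (''v'', []) = v" "nats s (''k'', []) = k" "\<And>u. u < v \<Longrightarrow> edge_done s u v"
    and v: "v \<le> sink" and s0: "nats s (''pred'', []) = 0"
  shows "runs q (For ''u'' (NConst 0) (NV ''v'') relax_com) s (400 * n)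
    (\<lambda>s'. best_cand s v k v (nats s' (''pred'', [])) (reals s' (''best'', [])))"
proof (rule runs_For[where L = 0 and H = v and B = 80 and
    I = "\<lambda>l s'. best_cand s v k l (nats s' (''pred'', [])) (reals s' (''best'', []))"])
  fix l s'
  assume l: "l < v" "nats s' (''u'', []) = l"
    and so: "same_outside (insert ''u'' (writes relax_com)) s s'"
    and I: "best_cand s v k l (nats s' (''pred'', [])) (reals s' (''best'', []))"
  have same: "cand s' v k = cand s v k" "cand_var s' v k = cand_var s v k" "edge_done s' l v"
    using so s(3)[OF l(1)] by (auto simp: cand_def cand_var_def same_outside_def edge_done_def fun_eq_iff)
  have "nats s' (''k'', []) = k"
    using so s(2) by (simp add: same_outside_def)
  from relax_com_correct[OF l(2) this same(3)]
  show "runs q relax_com s' 80 (\<lambda>s''. same_outside (writes relax_com) s' s'' \<longrightarrow>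
      best_cand s v k (Suc l) (nats (set_nat s'' ''u'' (Suc l)) (''pred'', []))
        (reals (set_nat s'' ''u'' (Suc l)) (''best'', [])))"
  proof (rule runs_mono[OF _ order_refl], intro impI)
    fix s'' :: store
    assume s'': "if cand s' v k l \<and> (nats s' (''pred'', []) = 0 \<or> cand_var s' v k l < reals s' (''best'', []))
      then nats s'' (''pred'', []) = Suc l \<and> reals s'' (''best'', []) = cand_var s' v k l
      else nats s'' (''pred'', []) = nats s' (''pred'', []) \<and> reals s'' (''best'', []) = reals s' (''best'', [])"
    show "best_cand s v k (Suc l) (nats (set_nat s'' ''u'' (Suc l)) (''pred'', []))
        (reals (set_nat s'' ''u'' (Suc l)) (''best'', []))"
      using s'' I same by (auto simp: best_cand_def less_Suc_eq split: if_splits)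
  qed
next
  have "v * 87 \<le> (4 * n) * 87"
    using v n by (intro mult_mono) auto
  then show "(v - 0) * (80 + ncost (NV ''v'') + 6) + ncost (NConst 0) + ncost (NV ''v'') + 3 \<le> 400 * n"
    using n by simp
next
  show "nval s' (NV ''v'') = v" if "same_outside (insert ''u'' (writes relax_com)) s s'" for s'
    using that s(1) by (simp add: same_outside_def)
qed (use s0 in \<open>auto simp: best_cand_def\<close>)

lemma copy_loop_correct:
  assumes s: "nodes_ok s" "nats s (''v'', []) = v" "nats s (''k'', []) = k"
      "nats s (''pred'', []) = Suc u \<Longrightarrow> edge_done s u v"
    and u: "nats s (''pred'', []) = Suc u \<Longrightarrow> u < v" and v: "v \<le> sink"
  shows "runs q (For ''r'' (NConst 1) (NAdd (NV ''n'') (NConst 1)) copy_com) s (100 * n) (\<lambda>s'.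
     (nats s (''pred'', []) = Suc u \<longrightarrow> (\<forall>r\<in>{1..end_time v}. reals s' (''X'', [v, k, r]) =
        (if tau u < r then fill u v r else reals s (''X'', [u, k - edge_supp u v, r])))) \<and>
     (\<forall>v' k' r. (v', k') \<noteq> (v, k) \<longrightarrow> reals s' (''X'', [v', k', r]) = reals s (''X'', [v', k', r])))"
proof (rule runs_For[where L = 1 and H = "n + 1" and B = 50 and I = "\<lambda>l s'.
     (nats s (''pred'', []) = Suc u \<longrightarrow> (\<forall>r\<in>{1..end_time v}. r < l \<longrightarrow> reals s' (''X'', [v, k, r]) =
        (if tau u < r then fill u v r else reals s (''X'', [u, k - edge_supp u v, r])))) \<and>
     (\<forall>v' k' r. (v', k') \<noteq> (v, k) \<longrightarrow> reals s' (''X'', [v', k', r]) = reals s (''X'', [v', k', r]))"])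
  fix l s'
  assume l: "nats s' (''r'', []) = l" and so: "same_outside (insert ''r'' (writes copy_com)) s s'"
    and I: "(nats s (''pred'', []) = Suc u \<longrightarrow> (\<forall>r\<in>{1..end_time v}. r < l \<longrightarrow> reals s' (''X'', [v, k, r]) =
        (if tau u < r then fill u v r else reals s (''X'', [u, k - edge_supp u v, r])))) \<and>
     (\<forall>v' k' r. (v', k') \<noteq> (v, k) \<longrightarrow> reals s' (''X'', [v', k', r]) = reals s (''X'', [v', k', r]))"
  have vk: "nats s' (''v'', []) = v" "nats s' (''k'', []) = k"
    using s so by (simp_all add: same_outside_def)
  have pred: "nats s' (''tau'', [u]) = tau u" "nats s' (''inc'', [u]) = edge_supp u v"
    "tau u < l \<Longrightarrow> l \<le> end_time v \<Longrightarrow> reals s' (''F'', [u, l]) = fill u v l"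
    "reals s' (''X'', [u, k - edge_supp u v, l]) = reals s (''X'', [u, k - edge_supp u v, l])"
    "nats s' (''pred'', []) = Suc u"
    if "nats s (''pred'', []) = Suc u"
  proof -
    have "tau u \<le> Suc n"
      using tau_mono[of u sink] u[OF that] v by simp
    then show "nats s' (''tau'', [u]) = tau u"
      using nodes_okD(3)[OF s(1)] so by (simp add: same_outside_def)
  qed (use that s(4)[OF that] u[OF that] so I in \<open>simp_all add: same_outside_def edge_done_def\<close>)
  show "runs q copy_com s' 50 (\<lambda>s''. same_outside (writes copy_com) s' s'' \<longrightarrow>
     (nats s (''pred'', []) = Suc u \<longrightarrow> (\<forall>r\<in>{1..end_time v}. r < Suc l \<longrightarrow>
        reals (set_nat s'' ''r'' (Suc l)) (''X'', [v, k, r]) =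
        (if tau u < r then fill u v r else reals s (''X'', [u, k - edge_supp u v, r])))) \<and>
     (\<forall>v' k' r. (v', k') \<noteq> (v, k) \<longrightarrow>
        reals (set_nat s'' ''r'' (Suc l)) (''X'', [v', k', r]) = reals s (''X'', [v', k', r])))"
  proof (cases "nats s (''pred'', []) = Suc u")
    case True
    then show ?thesis
      using I pred[OF True] unfolding copy_com_def
      by (auto simp: l vk less_Suc_eq)
  next
    case False
    then show ?thesis
      using I unfolding copy_com_def by (auto simp: l vk)
  qed
next
  fix s'
  assume "(nats s (''pred'', []) = Suc u \<longrightarrow> (\<forall>r\<in>{1..end_time v}. r < n + 1 \<longrightarrow> reals s' (''X'', [v, k, r]) =
        (if tau u < r then fill u v r else reals s (''X'', [u, k - edge_supp u v, r])))) \<and>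
     (\<forall>v' k' r. (v', k') \<noteq> (v, k) \<longrightarrow> reals s' (''X'', [v', k', r]) = reals s (''X'', [v', k', r]))"
  moreover have "r < n + 1" if "r \<in> {1..end_time v}" for r
    using that by (simp add: end_time_def)
  ultimately show "(nats s (''pred'', []) = Suc u \<longrightarrow> (\<forall>r\<in>{1..end_time v}. reals s' (''X'', [v, k, r]) =
        (if tau u < r then fill u v r else reals s (''X'', [u, k - edge_supp u v, r])))) \<and>
     (\<forall>v' k' r. (v', k') \<noteq> (v, k) \<longrightarrow> reals s' (''X'', [v', k', r]) = reals s (''X'', [v', k', r]))"
    by blast
next
  show "nval s' (NAdd (NV ''n'') (NConst 1)) = n + 1"
    if "same_outside (insert ''r'' (writes copy_com)) s s'" for s'
    using that nodes_okD(1)[OF s(1)] by (simp add: same_outside_def)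
qed (use n in auto)

lemma best_cand_same:
  assumes "same_outside W s s'" "''P'' \<notin> W" "''V'' \<notin> W"
  shows "best_cand s' = best_cand s"
proof -
  have "cand s' = cand s" "cand_var s' = cand_var s"
    using assms by (auto simp: fun_eq_iff cand_def cand_var_def same_outside_def)
  then show ?thesis
    by (simp add: fun_eq_iff best_cand_def)
qed

text \<open>
  The recursion of the dynamic program. A sequence for \<open>(v, k)\<close> is a sequence for the best
  predecessor, extended by an edge; conversely the last edge of any walk to \<open>v\<close> makes its
  origin a candidate.
\<close>

lemma cell_ok_if_best:
  assumes cells: "\<And>u j. u < v \<Longrightarrow> j \<le> n \<Longrightarrow> cell_ok s u j" and v: "0 < v" "v \<le> sink" and k: "k \<le> n"
    and best: "best_cand s v k v (nats s' (''P'', [v, k])) (reals s' (''V'', [v, k]))"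
    and X: "\<And>u r. nats s' (''P'', [v, k]) = Suc u \<Longrightarrow> 1 \<le> r \<Longrightarrow> r \<le> end_time v \<Longrightarrow> reals s' (''X'', [v, k, r]) =
        (if tau u < r then fill u v r else reals s (''X'', [u, k - edge_supp u v, r]))"
  shows "cell_ok s' v k"
  unfolding cell_ok_def
proof (intro conjI impI allI)
  assume "nats s' (''P'', [v, k]) \<noteq> 0"
  then obtain u where u: "nats s' (''P'', [v, k]) = Suc u"
    by (cases "nats s' (''P'', [v, k])") auto
  then have c: "u < v" "cand s v k u" "reals s' (''V'', [v, k]) = cand_var s v k u"
    using best by (auto simp: best_cand_def)
  let ?j = "k - edge_supp u v"
  have "cell_ok s u ?j"
    using cells c(1) k by simp
  then have "prefix_ok u ?j (\<lambda>r. reals s (''X'', [u, ?j, r])) (reals s (''V'', [u, ?j]))"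
    using c(2) by (simp add: cell_ok_def cand_def)
  then have "prefix_ok v (?j + edge_supp u v) (\<lambda>r. reals s' (''X'', [v, k, r]))
      (reals s (''V'', [u, ?j]) + edge_var u v)"
    by (rule prefix_extend) (use c v X[OF u] in \<open>auto simp: cand_def\<close>)
  then show "prefix_ok v k (\<lambda>r. reals s' (''X'', [v, k, r])) (reals s' (''V'', [v, k]))"
    using c by (simp add: cand_def cand_var_def)
next
  fix c
  assume "walk v k c"
  then obtain u j d where w: "walk u j d" "edge u v" "k = j + edge_supp u v" "c = d + edge_var u v"
    using v(1) by (cases rule: walk.cases) auto
  have u: "u < v"
    using w(2) tau_less_imp_less by (simp add: edge_def)
  have "cell_ok s u j"
    using cells u w(3) k by simp
  then have "nats s (''P'', [u, j]) \<noteq> 0" "reals s (''V'', [u, j]) \<le> d"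
    using w(1) by (auto simp: cell_ok_def)
  then have "cand s v k u" "cand_var s v k u \<le> c"
    using w by (auto simp: cand_def cand_var_def)
  then have "nats s' (''P'', [v, k]) \<noteq> 0 \<and> reals s' (''V'', [v, k]) \<le> c"
    using best u by (force simp: best_cand_def)
  then show "nats s' (''P'', [v, k]) \<noteq> 0" "reals s' (''V'', [v, k]) \<le> c"
    by auto
qed

lemma cell_com_correct:
  assumes s: "nodes_ok s" "nats s (''v'', []) = v" "nats s (''k'', []) = k"
      "\<And>u. u < v \<Longrightarrow> edge_done s u v" "\<And>u j. u < v \<Longrightarrow> j \<le> n \<Longrightarrow> cell_ok s u j"
    and v: "0 < v" "v \<le> sink" and k: "k \<le> n"
  shows "runs q cell_com s (600 * n)
    (\<lambda>s'. cell_ok s' v k \<and> (\<forall>v' k'. (v', k') \<noteq> (v, k) \<longrightarrow> same_cell s s' v' k'))"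
  unfolding cell_com_def
proof (rule runs_Sequ)
  show "runs q (NAssign ''pred'' [] (NConst 0) ;; RAssign ''best'' [] (RConst 0)) s 10
      (\<lambda>t. same_outside {''pred'', ''best''} s t \<and> nats t (''pred'', []) = 0)"
    by (simp add: same_outside_def)
next
  fix t
  assume t: "same_outside {''pred'', ''best''} s t \<and> nats t (''pred'', []) = 0"
  have best_t: "best_cand t = best_cand s"
    using t by (intro best_cand_same) auto
  have done_t: "edge_done t u v" if "u < v" for u
    using t s(4)[OF that] by (simp add: edge_done_def same_outside_def)
  let ?best = "\<lambda>t. best_cand s v k v (nats t (''pred'', [])) (reals t (''best'', []))"
  show "runs q (For ''u'' (NConst 0) (NV ''v'') relax_com ;;
     (NAssign ''P'' [NV ''v'', NV ''k''] (NV ''pred'') ;; RAssign ''V'' [NV ''v'', NV ''k''] (RV ''best'')) ;;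
     For ''r'' (NConst 1) (NAdd (NV ''n'') (NConst 1)) copy_com) t (530 * n)
    (\<lambda>s'. cell_ok s' v k \<and> (\<forall>v' k'. (v', k') \<noteq> (v, k) \<longrightarrow> same_cell s s' v' k'))"
  proof (rule runs_Sequ)
    have "runs q (For ''u'' (NConst 0) (NV ''v'') relax_com) t (400 * n)
        (\<lambda>t'. best_cand t v k v (nats t' (''pred'', [])) (reals t' (''best'', [])))"
      using t s v done_t by (intro relax_loop_correct) (auto simp: same_outside_def)
    from runs_with_frame[OF this]
    show "runs q (For ''u'' (NConst 0) (NV ''v'') relax_com) t (400 * n)
        (\<lambda>t'. same_outside {''pred'', ''best'', ''u''} s t' \<and> ?best t')"
      by (rule runs_mono[OF _ order_refl]) (use t best_t in \<open>auto simp: same_outside_def\<close>)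
  next
    fix t'
    assume t': "same_outside {''pred'', ''best'', ''u''} s t' \<and> ?best t'"
    then have vk: "nats t' (''v'', []) = v" "nats t' (''k'', []) = k"
      using s by (simp_all add: same_outside_def)
    show "runs q ((NAssign ''P'' [NV ''v'', NV ''k''] (NV ''pred'') ;; RAssign ''V'' [NV ''v'', NV ''k''] (RV ''best'')) ;;
       For ''r'' (NConst 1) (NAdd (NV ''n'') (NConst 1)) copy_com) t' (130 * n)
      (\<lambda>s'. cell_ok s' v k \<and> (\<forall>v' k'. (v', k') \<noteq> (v, k) \<longrightarrow> same_cell s s' v' k'))"
    proof (rule runs_Sequ)
      let ?W = "{''pred'', ''best'', ''u'', ''P'', ''V''}"
      let ?Q = "\<lambda>t. same_outside ?W s t \<and> ?best t \<and>
         nats t (''P'', [v, k]) = nats t (''pred'', []) \<and> reals t (''V'', [v, k]) = reals t (''best'', []) \<and>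
         (\<forall>v' k'. (v', k') \<noteq> (v, k) \<longrightarrow> same_cell s t v' k')"
      show "runs q (NAssign ''P'' [NV ''v'', NV ''k''] (NV ''pred'') ;; RAssign ''V'' [NV ''v'', NV ''k''] (RV ''best''))
          t' 20 ?Q"
        using t' by (simp add: vk) (auto simp: same_outside_def same_cell_def)
      fix w
      assume w: "?Q w"
      then have so: "same_outside ?W s w"
        by simp
      obtain u where u: "nats w (''pred'', []) = 0 \<or> nats w (''pred'', []) = Suc u"
        by (cases "nats w (''pred'', [])") auto
      have u_v: "u < v" if "nats w (''pred'', []) = Suc u"
        using w that by (simp add: best_cand_def)
      have "runs q (For ''r'' (NConst 1) (NAdd (NV ''n'') (NConst 1)) copy_com) w (100 * n) (\<lambda>s'.
       (nats w (''pred'', []) = Suc u \<longrightarrow> (\<forall>r\<in>{1..end_time v}. reals s' (''X'', [v, k, r]) =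
          (if tau u < r then fill u v r else reals w (''X'', [u, k - edge_supp u v, r])))) \<and>
       (\<forall>v' k' r. (v', k') \<noteq> (v, k) \<longrightarrow> reals s' (''X'', [v', k', r]) = reals w (''X'', [v', k', r])))"
      proof (rule copy_loop_correct)
        show "nodes_ok w"
          by (rule nodes_ok_same[OF s(1) so]) simp
        show "edge_done w u v" if "nats w (''pred'', []) = Suc u"
          using s(4)[OF u_v[OF that]] so by (simp add: edge_done_def same_outside_def)
      qed (use s so v u_v in \<open>auto simp: same_outside_def\<close>)
      from runs_with_frame[OF this]
      show "runs q (For ''r'' (NConst 1) (NAdd (NV ''n'') (NConst 1)) copy_com) w (100 * n)
          (\<lambda>s'. cell_ok s' v k \<and> (\<forall>v' k'. (v', k') \<noteq> (v, k) \<longrightarrow> same_cell s s' v' k'))"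
      proof (rule runs_mono[OF _ order_refl], elim conjE)
        fix s'
        assume so': "same_outside (writes (For ''r'' (NConst 1) (NAdd (NV ''n'') (NConst 1)) copy_com)) w s'"
          and X: "nats w (''pred'', []) = Suc u \<longrightarrow> (\<forall>r\<in>{1..end_time v}. reals s' (''X'', [v, k, r]) =
          (if tau u < r then fill u v r else reals w (''X'', [u, k - edge_supp u v, r])))"
          and X': "\<forall>v' k' r. (v', k') \<noteq> (v, k) \<longrightarrow> reals s' (''X'', [v', k', r]) = reals w (''X'', [v', k', r])"
        have PV: "nats s' (''P'', is) = nats w (''P'', is)" "reals s' (''V'', is) = reals w (''V'', is)" for "is"
          using so' by (simp_all add: same_outside_def)
        have X_w: "reals w (''X'', is) = reals s (''X'', is)" for "is"
          using so by (simp add: same_outside_def)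
        have "cell_ok s' v k"
        proof (rule cell_ok_if_best[OF s(5) v k])
          show "best_cand s v k v (nats s' (''P'', [v, k])) (reals s' (''V'', [v, k]))"
            using w PV by simp
          show "reals s' (''X'', [v, k, r]) =
              (if tau u' < r then fill u' v r else reals s (''X'', [u', k - edge_supp u' v, r]))"
            if "nats s' (''P'', [v, k]) = Suc u'" "1 \<le> r" "r \<le> end_time v" for u' r
            using that w PV X u X_w by auto
        qed
        moreover have "same_cell s s' v' k'" if "(v', k') \<noteq> (v, k)" for v' k'
          using that w PV X' X_w by (simp add: same_cell_def)
        ultimately show "cell_ok s' v k \<and> (\<forall>v' k'. (v', k') \<noteq> (v, k) \<longrightarrow> same_cell s s' v' k')"
          by blast
      qed
    qed (use n in simp)
  qed simp
qed (use n in simp)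

end

context tube
begin

lemma dp_init_correct:
  assumes "nodes_ok s"
  shows "runs q (For ''k'' (NConst 0) (NAdd (NV ''n'') (NConst 1))
       (NAssign ''P'' [NConst 0, NV ''k''] (NConst 1) ;; RAssign ''V'' [NConst 0, NV ''k''] (RConst 0)))
     s (100 * n) (\<lambda>s'. \<forall>k\<le>n. cell_ok s' 0 k)"
proof (rule runs_For[where L = 0 and H = "n + 1" and B = 20 and
    I = "\<lambda>l s'. \<forall>k<l. nats s' (''P'', [0, k]) = 1 \<and> reals s' (''V'', [0, k]) = 0"])
  fix s' :: store
  assume s': "\<forall>k<n + 1. nats s' (''P'', [0, k]) = 1 \<and> reals s' (''V'', [0, k]) = 0"
  have walk_0: "c = 0" if "walk 0 k c" for k c
    using that by cases (auto simp: edge_def)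
  have "cell_ok s' 0 k" if "k \<le> n" for k
    using s' that walk_0 by (auto simp: cell_ok_def prefix_ok_def end_time_def supp_def var_def)
  then show "\<forall>k\<le>n. cell_ok s' 0 k"
    by blast
next
  show "nval s' (NAdd (NV ''n'') (NConst 1)) = n + 1"
    if "same_outside (insert ''k'' (writes (NAssign ''P'' [NConst 0, NV ''k''] (NConst 1) ;;
      RAssign ''V'' [NConst 0, NV ''k''] (RConst 0)))) s s'" for s'
    using that nodes_okD(1)[OF assms] by (simp add: same_outside_def)
qed (use n in \<open>auto simp: less_Suc_eq\<close>)

lemma dp_row_correct:
  assumes s: "nodes_ok s" "nats s (''v'', []) = v" "\<And>u j. u < v \<Longrightarrow> j \<le> n \<Longrightarrow> cell_ok s u j"
    and v: "0 < v" "v \<le> sink"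
  shows "runs q (edges_com q ;; For ''k'' (NConst 0) (NAdd (NV ''n'') (NConst 1)) cell_com) s (3100 * n^2)
    (\<lambda>s'. \<forall>u\<le>v. \<forall>j\<le>n. cell_ok s' u j)"
proof (rule runs_Sequ[OF runs_with_frame[OF edges_com_correct[OF s(1,2) v(2)]]])
  fix t
  assume "same_outside (writes (edges_com q)) s t \<and> (\<forall>u<v. edge_done t u v)"
  then have so: "same_outside (writes (edges_com q)) s t" and edges: "\<And>u. u < v \<Longrightarrow> edge_done t u v"
    by auto
  have nodes: "nodes_ok t"
    by (rule nodes_ok_same[OF s(1) so]) simp
  have v_t: "nats t (''v'', []) = v"
    using so s(2) by (simp add: same_outside_def)
  have cells: "cell_ok t u j" if "u < v" "j \<le> n" for u j
    by (rule cell_ok_same[OF s(3)[OF that]]) (use so in \<open>simp add: same_cell_def same_outside_def\<close>)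
  show "runs q (For ''k'' (NConst 0) (NAdd (NV ''n'') (NConst 1)) cell_com) t (1400 * n^2)
      (\<lambda>s'. \<forall>u\<le>v. \<forall>j\<le>n. cell_ok s' u j)"
  proof (rule runs_For[where L = 0 and H = "n + 1" and B = "600 * n" and
      I = "\<lambda>k s'. (\<forall>u<v. \<forall>j\<le>n. cell_ok s' u j) \<and> (\<forall>j<k. cell_ok s' v j) \<and> (\<forall>u<v. edge_done s' u v)"])
    fix k s'
    assume k: "k < n + 1" "nats s' (''k'', []) = k"
      and so': "same_outside (insert ''k'' (writes cell_com)) t s'"
      and I: "(\<forall>u<v. \<forall>j\<le>n. cell_ok s' u j) \<and> (\<forall>j<k. cell_ok s' v j) \<and> (\<forall>u<v. edge_done s' u v)"
    have "runs q cell_com s' (600 * n)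
        (\<lambda>s''. cell_ok s'' v k \<and> (\<forall>v' k'. (v', k') \<noteq> (v, k) \<longrightarrow> same_cell s' s'' v' k'))"
    proof (rule cell_com_correct)
      show "nodes_ok s'"
        by (rule nodes_ok_same[OF nodes so']) simp
      show "nats s' (''v'', []) = v"
        using so' v_t by (simp add: same_outside_def)
    qed (use I k v in auto)
    then show "runs q cell_com s' (600 * n) (\<lambda>s''. same_outside (writes cell_com) s' s'' \<longrightarrow>
        (\<forall>u<v. \<forall>j\<le>n. cell_ok (set_nat s'' ''k'' (Suc k)) u j) \<and>
        (\<forall>j<Suc k. cell_ok (set_nat s'' ''k'' (Suc k)) v j) \<and>
        (\<forall>u<v. edge_done (set_nat s'' ''k'' (Suc k)) u v))"
    proof (rule runs_mono[OF _ order_refl], intro impI)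
      fix s'' :: store
      assume s'': "cell_ok s'' v k \<and> (\<forall>v' k'. (v', k') \<noteq> (v, k) \<longrightarrow> same_cell s' s'' v' k')"
        and so'': "same_outside (writes cell_com) s' s''"
      have set: "cell_ok (set_nat s'' ''k'' (Suc k)) u j \<longleftrightarrow> cell_ok s'' u j" for u j
        by (simp add: cell_ok_def)
      have "cell_ok s'' u j" if "u < v" "j \<le> n" for u j
        using that I s'' cell_ok_same[of s' u j s''] by auto
      moreover have "cell_ok s'' v j" if "j < Suc k" for j
        using that I s'' cell_ok_same[of s' v j s''] by (cases "j = k") auto
      moreover have "edge_done (set_nat s'' ''k'' (Suc k)) u v" if "u < v" for u
        using that I so'' by (simp add: edge_done_def same_outside_def)
      ultimately show "(\<forall>u<v. \<forall>j\<le>n. cell_ok (set_nat s'' ''k'' (Suc k)) u j) \<and>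
        (\<forall>j<Suc k. cell_ok (set_nat s'' ''k'' (Suc k)) v j) \<and>
        (\<forall>u<v. edge_done (set_nat s'' ''k'' (Suc k)) u v)"
        by (simp add: set)
    qed
  next
    show "nval s' (NAdd (NV ''n'') (NConst 1)) = n + 1"
      if "same_outside (insert ''k'' (writes cell_com)) t s'" for s'
      using that nodes_okD(1)[OF nodes] by (simp add: same_outside_def)
    show "(\<forall>u<v. \<forall>j\<le>n. cell_ok (set_nat t ''k'' 0) u j) \<and> (\<forall>j<0. cell_ok (set_nat t ''k'' 0) v j) \<and>
        (\<forall>u<v. edge_done (set_nat t ''k'' 0) u v)"
      using cells edges by (simp add: cell_ok_def edge_done_def)
    have "(n + 1) * (600 * n + 9) \<le> (2 * n) * (609 * n)"
      using n by (intro mult_mono) auto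
    then have "(n + 1) * (600 * n + 9) \<le> 1218 * n^2"
      by (simp add: power2_eq_square)
    moreover have "1 \<le> n^2"
      using n by simp
    ultimately have "(n + 1) * (600 * n + 9) + 7 \<le> 1400 * n^2"
      by linarith
    then show "(n + 1 - 0) * (600 * n + ncost (NAdd (NV ''n'') (NConst 1)) + 6) + ncost (NConst 0) +
        ncost (NAdd (NV ''n'') (NConst 1)) + 3 \<le> 1400 * n^2"
      by (simp add: algebra_simps)
    show "\<forall>u\<le>v. \<forall>j\<le>n. cell_ok s' u j"
      if "(\<forall>u<v. \<forall>j\<le>n. cell_ok s' u j) \<and> (\<forall>j<n + 1. cell_ok s' v j) \<and> (\<forall>u<v. edge_done s' u v)" for s'
      using that by (auto simp: le_less less_Suc_eq)
  qed auto
qed simp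

lemma dp_com_correct:
  assumes s: "nodes_ok s"
  shows "runs q (dp_com q) s (13000 * n^3) (\<lambda>s'. \<forall>k\<le>n. cell_ok s' sink k)"
  unfolding dp_com_def
proof (rule runs_Sequ[OF runs_with_frame[OF dp_init_correct[OF s]]])
  let ?init = "For ''k'' (NConst 0) (NAdd (NV ''n'') (NConst 1))
       (NAssign ''P'' [NConst 0, NV ''k''] (NConst 1) ;; RAssign ''V'' [NConst 0, NV ''k''] (RConst 0))"
  let ?row = "edges_com q ;; For ''k'' (NConst 0) (NAdd (NV ''n'') (NConst 1)) cell_com"
  fix t
  assume "same_outside (writes ?init) s t \<and> (\<forall>k\<le>n. cell_ok t 0 k)"
  then have so: "same_outside (writes ?init) s t" and cells: "\<And>k. k \<le> n \<Longrightarrow> cell_ok t 0 k"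
    by auto
  have nodes: "nodes_ok t"
    by (rule nodes_ok_same[OF s so]) simp
  show "runs q (For ''v'' (NConst 1) (NAdd (NV ''M'') (NConst 1)) ?row) t (12900 * n^3)
      (\<lambda>s'. \<forall>k\<le>n. cell_ok s' sink k)"
  proof (rule runs_For[where L = 1 and H = "sink + 1" and B = "3100 * n^2" and
      I = "\<lambda>v s'. \<forall>u<v. \<forall>j\<le>n. cell_ok s' u j"])
    fix v s'
    assume v: "1 \<le> v" "v < sink + 1" "nats s' (''v'', []) = v"
      and so': "same_outside (insert ''v'' (writes ?row)) t s'"
      and I: "\<forall>u<v. \<forall>j\<le>n. cell_ok s' u j"
    have "runs q ?row s' (3100 * n^2) (\<lambda>s'. \<forall>u\<le>v. \<forall>j\<le>n. cell_ok s' u j)"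
    proof (rule dp_row_correct)
      show "nodes_ok s'"
        by (rule nodes_ok_same[OF nodes so']) simp
    qed (use v I in auto)
    then show "runs q ?row s' (3100 * n^2) (\<lambda>s''. same_outside (writes ?row) s' s'' \<longrightarrow>
        (\<forall>u<Suc v. \<forall>j\<le>n. cell_ok (set_nat s'' ''v'' (Suc v)) u j))"
      by (rule runs_mono[OF _ order_refl]) (simp add: cell_ok_def less_Suc_eq_le)
  next
    show "nval s' (NAdd (NV ''M'') (NConst 1)) = sink + 1"
      if "same_outside (insert ''v'' (writes ?row)) t s'" for s'
      using that nodes_okD(2)[OF nodes] by (simp add: same_outside_def)
    show "\<forall>u<1. \<forall>j\<le>n. cell_ok (set_nat t ''v'' 1) u j"
      using cells by (simp add: cell_ok_def)
    have n2: "1 \<le> n^2"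
      using n by simp
    have "sink * (3100 * n^2 + 9) \<le> (4 * n) * (3109 * n^2)"
      using n n2 by (intro mult_mono) auto
    then have "sink * (3100 * n^2 + 9) \<le> 12436 * n^3"
      by (simp add: power2_eq_square power3_eq_cube)
    moreover have "1 \<le> n^3"
      using n by simp
    ultimately have "sink * (3100 * n^2 + 9) + 7 \<le> 12900 * n^3"
      by linarith
    then show "(sink + 1 - 1) * (3100 * n^2 + ncost (NAdd (NV ''M'') (NConst 1)) + 6) + ncost (NConst 1) +
        ncost (NAdd (NV ''M'') (NConst 1)) + 3 \<le> 12900 * n^3"
      by (simp add: algebra_simps)
  qed auto
next
  have "n \<le> n^3"
    using n by (intro self_le_power) auto
  then show "100 * n + 12900 * n^3 \<le> 13000 * n^3"
    by linarith
qed

definition same_output :: "store \<Rightarrow> store \<Rightarrow> nat \<Rightarrow> bool" where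
  "same_output s s' i \<longleftrightarrow> nats s' (''count'', [i]) = nats s (''count'', [i]) \<and>
     (\<forall>k t. reals s' (''theta'', [i, k, t]) = reals s (''theta'', [i, k, t]))"

text \<open>
  Every sequence in the tube is dominated, in support and in variation at the same time, by
  one of the listed sequences. Therefore the list does not depend on \<open>\<gamma>\<close>.
\<close>

definition coord_ok :: "store \<Rightarrow> nat \<Rightarrow> bool" where
  "coord_ok s i \<longleftrightarrow> nats s (''count'', [i]) = n + 1 \<and>
     (\<forall>k\<le>n. in_tube (\<lambda>r. reals s (''theta'', [i, k, r - 1]))) \<and>
     (\<forall>x. in_tube x \<longrightarrow> (\<exists>k\<le>n. supp (\<lambda>r. reals s (''theta'', [i, k, r - 1])) 0 n \<le> supp x 0 n \<and>
        var (\<lambda>r. reals s (''theta'', [i, k, r - 1])) 1 n \<le> var x 1 n))"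

lemma coord_ok_same: "coord_ok s i \<Longrightarrow> same_output s s' i \<Longrightarrow> coord_ok s' i"
  by (simp add: coord_ok_def same_output_def)

lemma output_loop_correct:
  assumes s: "nodes_ok s" "nats s (''i'', []) = i"
  defines "out \<equiv> \<lambda>k r. if nats s (''P'', [sink, k]) \<noteq> 0 then reals s (''X'', [sink, k, r])
    else reals s (''m'', [r - 1, i])"
  shows "runs q output_com s (200 * n^2) (\<lambda>s'. nats s' (''count'', [i]) = n + 1 \<and>
     (\<forall>k\<le>n. \<forall>r\<in>{1..n}. reals s' (''theta'', [i, k, r - 1]) = out k r) \<and>
     (\<forall>i'. i' \<noteq> i \<longrightarrow> same_output s s' i'))"
  unfolding output_com_def
proof (rule runs_Sequ)
  let ?body = "Cond (NLess (NConst 0) (NCell ''P'' [NV ''M'', NV ''k'']))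
           (RAssign ''theta'' [NV ''i'', NV ''k'', NSub (NV ''r'') (NConst 1)]
             (RCell ''X'' [NV ''M'', NV ''k'', NV ''r'']))
           (RAssign ''theta'' [NV ''i'', NV ''k'', NSub (NV ''r'') (NConst 1)]
             (RCell ''m'' [NSub (NV ''r'') (NConst 1), NV ''i'']))"
  let ?inner = "For ''r'' (NConst 1) (NAdd (NV ''n'') (NConst 1)) ?body"
  define I where "I k l s' \<longleftrightarrow>
     (\<forall>k'<k. \<forall>r\<in>{1..n}. reals s' (''theta'', [i, k', r - 1]) = out k' r) \<and>
     (\<forall>r\<in>{1..<l}. reals s' (''theta'', [i, k, r - 1]) = out k r) \<and>
     (\<forall>i' k t. i' \<noteq> i \<longrightarrow> reals s' (''theta'', [i', k, t]) = reals s (''theta'', [i', k, t]))"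
    for k l and s' :: store
  let ?W = "{''k'', ''r'', ''theta''}"
  have inner: "runs q ?inner s1 (50 * n) (\<lambda>s'. I k (n + 1) s')"
    if s1: "same_outside ?W s s1" "nats s1 (''k'', []) = k" "I k 1 s1" for s1 k
  proof (rule runs_For[where L = 1 and H = "n + 1" and B = 25 and I = "I k"])
    have n_s1: "nats s1 (''n'', []) = n" "nats s1 (''M'', []) = sink"
      using s1 nodes_okD(1,2)[OF s(1)] by (simp_all add: same_outside_def)
    show "nval s' (NAdd (NV ''n'') (NConst 1)) = n + 1" if "same_outside (insert ''r'' (writes ?body)) s1 s'" for s'
      using that n_s1 by (simp add: same_outside_def)
    fix r s'
    assume r: "1 \<le> r" "r < n + 1" "nats s' (''r'', []) = r"
      and so: "same_outside (insert ''r'' (writes ?body)) s1 s'" and I: "I k r s'"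
    have vals: "nats s' (''M'', []) = sink" "nats s' (''k'', []) = k" "nats s' (''i'', []) = i"
      "nats s' (''P'', [sink, k]) = nats s (''P'', [sink, k])"
      "reals s' (''X'', [sink, k, r]) = reals s (''X'', [sink, k, r])"
      "reals s' (''m'', [r - 1, i]) = reals s (''m'', [r - 1, i])"
      using so s1(1,2) n_s1 s(2) by (simp_all add: same_outside_def)
    have "I k (Suc r) (set_nat (s'\<lparr>reals := (reals s')((''theta'', [i, k, r - 1]) := out k r)\<rparr>) ''r'' (Suc r))"
      using I r by (auto simp: I_def less_Suc_eq)
    then show "runs q ?body s' 25 (\<lambda>s''. same_outside (writes ?body) s' s'' \<longrightarrow>
        I k (Suc r) (set_nat s'' ''r'' (Suc r)))"
      using vals r(3) by (cases "nats s (''P'', [sink, k]) = 0") (simp_all add: out_def)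
  qed (use n s1 in \<open>auto simp: I_def\<close>)
  show "runs q (For ''k'' (NConst 0) (NAdd (NV ''n'') (NConst 1)) ?inner) s (150 * n^2)
      (\<lambda>s'. same_outside ?W s s' \<and> I (n + 1) 1 s')"
  proof (rule runs_For[where L = 0 and H = "n + 1" and B = "50 * n" and I = "\<lambda>k. I k 1"])
    fix k s'
    assume k: "nats s' (''k'', []) = k" and so: "same_outside (insert ''k'' (writes ?inner)) s s'"
      and I: "I k 1 s'"
    have "same_outside ?W s s'"
      using so by (simp add: insert_commute)
    from inner[OF this k I]
    show "runs q ?inner s' (50 * n) (\<lambda>s''. same_outside (writes ?inner) s' s'' \<longrightarrow>
        I (Suc k) 1 (set_nat s'' ''k'' (Suc k)))"
      by (rule runs_mono[OF _ order_refl]) (auto simp: I_def less_Suc_eq)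
  next
    show "nval s' (NAdd (NV ''n'') (NConst 1)) = n + 1" if "same_outside (insert ''k'' (writes ?inner)) s s'" for s'
      using that nodes_okD(1)[OF s(1)] by (simp add: same_outside_def)
    show "same_outside ?W s s' \<and> I (n + 1) 1 s'"
      if "same_outside (insert ''k'' (writes ?inner)) s s'" "I (n + 1) 1 s'" for s'
      using that by (simp add: insert_commute)
    have "(n + 1) * (50 * n + 9) \<le> (2 * n) * (59 * n)"
      using n by (intro mult_mono) auto
    then have "(n + 1) * (50 * n + 9) \<le> 118 * n^2"
      by (simp add: power2_eq_square)
    moreover have "1 \<le> n^2"
      using n by simp
    ultimately have "(n + 1) * (50 * n + 9) + 7 \<le> 150 * n^2"
      by linarith
    then show "(n + 1 - 0) * (50 * n + ncost (NAdd (NV ''n'') (NConst 1)) + 6) + ncost (NConst 0) +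
        ncost (NAdd (NV ''n'') (NConst 1)) + 3 \<le> 150 * n^2"
      by (simp add: algebra_simps)
  qed (auto simp: I_def)
  fix t
  assume t: "same_outside ?W s t \<and> I (n + 1) 1 t"
  then show "runs q (NAssign ''count'' [NV ''i''] (NAdd (NV ''n'') (NConst 1))) t 20
     (\<lambda>s'. nats s' (''count'', [i]) = n + 1 \<and>
     (\<forall>k\<le>n. \<forall>r\<in>{1..n}. reals s' (''theta'', [i, k, r - 1]) = out k r) \<and>
     (\<forall>i'. i' \<noteq> i \<longrightarrow> same_output s s' i'))"
    using s nodes_okD(1)[OF s(1)] by (simp add: same_outside_def I_def same_output_def less_Suc_eq_le)
next
  have "1 \<le> n^2"
    using n by simp
  then show "150 * n^2 + 20 \<le> 200 * n^2"
    by linarith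
qed

text \<open>
  The sequence that dominates \<open>x\<close> is the one listed for \<open>k = supp x 0 n\<close>, since the walk
  that dominates \<open>x\<close> ends in this table entry.
\<close>

lemma output_com_correct:
  assumes s: "nodes_ok s" "nats s (''i'', []) = i" "\<And>k. k \<le> n \<Longrightarrow> cell_ok s sink k"
    and m: "in_tube (\<lambda>r. reals s (''m'', [r - 1, i]))"
  shows "runs q output_com s (200 * n^2) (\<lambda>s'. coord_ok s' i \<and> (\<forall>i'. i' \<noteq> i \<longrightarrow> same_output s s' i'))"
proof (rule runs_mono[OF output_loop_correct[OF s(1,2)] order_refl])
  fix s' :: store
  let ?out = "\<lambda>k r. if nats s (''P'', [sink, k]) \<noteq> 0 then reals s (''X'', [sink, k, r])
    else reals s (''m'', [r - 1, i])"
  let ?th = "\<lambda>k r. reals s' (''theta'', [i, k, r - 1])"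
  assume s': "nats s' (''count'', [i]) = n + 1 \<and>
     (\<forall>k\<le>n. \<forall>r\<in>{1..n}. ?th k r = ?out k r) \<and> (\<forall>i'. i' \<noteq> i \<longrightarrow> same_output s s' i')"
  have end_sink: "end_time sink = n"
    by (simp add: end_time_def)
  have prefix: "prefix_ok sink k (\<lambda>r. reals s (''X'', [sink, k, r])) (reals s (''V'', [sink, k]))"
    if "k \<le> n" "nats s (''P'', [sink, k]) \<noteq> 0" for k
    using s(3)[OF that(1)] that(2) by (simp add: cell_ok_def)
  have "in_tube (?th k)" if k: "k \<le> n" for k
  proof (cases "nats s (''P'', [sink, k]) = 0")
    case True
    then show ?thesis
      using s' k m by (simp add: in_tube_def)
  next
    case False
    then show ?thesis
      using s' k prefix[OF k False] end_sink by (simp add: in_tube_def prefix_ok_def)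
  qed
  moreover have "\<exists>k\<le>n. supp (?th k) 0 n \<le> supp x 0 n \<and> var (?th k) 1 n \<le> var x 1 n"
    if x: "in_tube x" for x
  proof -
    obtain j c where "walk sink j c" "j \<le> supp x 0 n" and c: "c \<le> var x 1 n"
      using ex_walk[OF x] by blast
    then have w: "walk sink (supp x 0 n) c"
      by (blast intro: walk_mono)
    let ?k = "supp x 0 n"
    have "?k \<le> card {0<..n}"
      unfolding supp_def by (intro card_mono) auto
    then have k: "?k \<le> n"
      by simp
    have P: "nats s (''P'', [sink, ?k]) \<noteq> 0" "reals s (''V'', [sink, ?k]) \<le> c"
      using s(3)[OF k] w by (simp_all add: cell_ok_def)
    have eq: "?th ?k r = reals s (''X'', [sink, ?k, r])" if "1 \<le> r" "r \<le> n" for r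
      using s' k P that by simp
    have "supp (?th ?k) 0 n = supp (\<lambda>r. reals s (''X'', [sink, ?k, r])) 0 n"
      using eq by (intro supp_cong) auto
    moreover have "var (?th ?k) 1 n = var (\<lambda>r. reals s (''X'', [sink, ?k, r])) 1 n"
      using eq by (intro var_cong) auto
    ultimately have "supp (?th ?k) 0 n \<le> ?k" "var (?th ?k) 1 n \<le> var x 1 n"
      using prefix[OF k P(1)] P(2) c end_sink by (auto simp: prefix_ok_def)
    then show ?thesis
      using k by blast
  qed
  ultimately show "coord_ok s' i \<and> (\<forall>i'. i' \<noteq> i \<longrightarrow> same_output s s' i')"
    using s' by (simp add: coord_ok_def)
qed

text \<open>
  The centre of the tube is assumed to lie in it, which holds because the radii are
  nonnegative; it is what the output falls back on for unreachable bounds.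
\<close>

lemma coord_com_correct:
  assumes s: "nats s (''n'', []) = n" "nats s (''M'', []) = sink" "nats s (''i'', []) = i"
    and a: "\<And>t. a t = reals s (''m'', [t - 1, i]) - reals s (''lambda'', [t - 1])"
    and b: "\<And>t. b t = reals s (''m'', [t - 1, i]) + reals s (''lambda'', [t - 1])"
    and m: "in_tube (\<lambda>r. reals s (''m'', [r - 1, i]))"
  shows "runs q (coord_com q) s (14000 * n^3) (\<lambda>s'. coord_ok s' i \<and> (\<forall>i'. i' \<noteq> i \<longrightarrow> same_output s s' i'))"
  unfolding coord_com_def
proof (rule runs_Sequ)
  show "runs q nodes_com s (500 * n) (\<lambda>t. same_outside (writes nodes_com) s t \<and> nodes_ok t)"
    using s a b by (intro runs_with_frame nodes_com_correct) auto
  fix t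
  assume t: "same_outside (writes nodes_com) s t \<and> nodes_ok t"
  show "runs q (dp_com q ;; output_com) t (13200 * n^3)
      (\<lambda>s'. coord_ok s' i \<and> (\<forall>i'. i' \<noteq> i \<longrightarrow> same_output s s' i'))"
  proof (rule runs_Sequ)
    show "runs q (dp_com q) t (13000 * n^3)
        (\<lambda>t'. same_outside (writes (dp_com q)) t t' \<and> (\<forall>k\<le>n. cell_ok t' sink k))"
      using t by (intro runs_with_frame dp_com_correct) auto
    fix t'
    assume t': "same_outside (writes (dp_com q)) t t' \<and> (\<forall>k\<le>n. cell_ok t' sink k)"
    have nodes: "nodes_ok t'"
      using nodes_ok_same[of t "writes (dp_com q)" t'] t t' by simp
    have "runs q output_com t' (200 * n^2) (\<lambda>s'. coord_ok s' i \<and> (\<forall>i'. i' \<noteq> i \<longrightarrow> same_output t' s' i'))"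
    proof (rule output_com_correct[OF nodes])
      show "nats t' (''i'', []) = i"
        using s(3) t t' by (simp add: same_outside_def)
      have "(\<lambda>r. reals t' (''m'', [r - 1, i])) = (\<lambda>r. reals s (''m'', [r - 1, i]))"
        using t t' by (simp add: same_outside_def)
      then show "in_tube (\<lambda>r. reals t' (''m'', [r - 1, i]))"
        using m by simp
    qed (use t' in simp)
    then show "runs q output_com t' (200 * n^2) (\<lambda>s'. coord_ok s' i \<and> (\<forall>i'. i' \<noteq> i \<longrightarrow> same_output s s' i'))"
      by (rule runs_mono[OF _ order_refl]) (use t t' in \<open>simp add: same_output_def same_outside_def\<close>)
  next
    have "n^2 \<le> n^3"
      using n by (intro power_increasing) auto
    then show "13000 * n^3 + 200 * n^2 \<le> 13200 * n^3"
      by linarith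
  qed
next
  have "n \<le> n^3"
    using n by (intro self_le_power) auto
  then show "500 * n + 13200 * n^3 \<le> 14000 * n^3"
    by linarith
qed

end

section \<open>All coordinates\<close>

lemma card_eq_sum_of_bool: "finite B \<Longrightarrow> real (card {x \<in> B. P x}) = (\<Sum>x\<in>B. of_bool (P x))"
  by (simp add: sum.If_cases of_bool_def Collect_conj_eq)

lemma sum_norm_0:
  fixes \<theta> :: "nat \<Rightarrow> nat \<Rightarrow> real"
  assumes "finite A"
  shows "(\<Sum>t\<in>A. real (norm_0 p (\<theta> t))) = (\<Sum>i=1..p. real (card {t \<in> A. \<theta> t i \<noteq> 0}))"
  unfolding norm_0_def card_eq_sum_of_bool[OF finite_atLeastAtMost] card_eq_sum_of_bool[OF assms]
  by (rule sum.swap)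

lemma norm_pow_eq_sum: "norm_pow q p v = (\<Sum>i=1..p. abs_pow q (v i))"
  unfolding norm_pow_def norm_0_def abs_pow_def card_eq_sum_of_bool[OF finite_atLeastAtMost] by simp

lemma objective_eq_sum: "objective q p T \<gamma> \<theta> = (\<Sum>i=1..p. coord_objective q T \<gamma> (\<lambda>t. \<theta> t i))"
proof -
  have "(\<Sum>t=1..T. norm_pow q p (\<lambda>i. \<theta> t i - \<theta> (t - 1) i)) =
      (\<Sum>i=1..p. \<Sum>t=1..T. abs_pow q (\<theta> t i - \<theta> (t - 1) i))"
    unfolding norm_pow_eq_sum by (rule sum.swap)
  then show ?thesis
    unfolding objective_def coord_objective_def sum_norm_0[OF finite_atLeastAtMost]
    by (simp only: sum_distrib_left sum.distrib)
qed

lemma feasible_iff: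
  assumes "1 \<le> p"
  shows "feasible p T m lam \<theta> \<longleftrightarrow> (\<forall>i\<in>{1..p}. \<forall>t\<le>T. \<bar>\<theta> t i - m t i\<bar> \<le> lam t)"
proof -
  have *: "norm_inf p v \<le> l \<longleftrightarrow> (\<forall>i\<in>{1..p}. \<bar>v i\<bar> \<le> l)" for v l
    unfolding norm_inf_def using assms by (subst Max_le_iff) auto
  show ?thesis
    unfolding feasible_def * by blast
qed

lemma coord_objective_eq:
  "coord_objective q T \<gamma> x =
     \<gamma> * real (tube.supp (\<lambda>r. x (r - 1)) 0 (Suc T)) + (1 - \<gamma>) * tube.var q (\<lambda>r. x (r - 1)) 1 (Suc T)"
  if "tube q n"
proof -
  interpret tube q n a b for a b
    by (rule that)
  have "{r \<in> {0<..Suc T}. x (r - 1) \<noteq> 0} = Suc ` {t \<in> {0..T}. x t \<noteq> 0}"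
    by (force simp: image_iff Bex_def gr0_conv_Suc Suc_le_eq)
  then have "supp (\<lambda>r. x (r - 1)) 0 (Suc T) = card {t \<in> {0..T}. x t \<noteq> 0}"
    by (simp add: supp_def card_image)
  moreover have "var (\<lambda>r. x (r - 1)) 1 (Suc T) = (\<Sum>t=1..T. abs_pow q (x t - x (t - 1)))"
    unfolding var_def by (rule sum.reindex_bij_witness[of _ Suc "\<lambda>r. r - 1"]) auto
  ultimately show ?thesis
    by (simp add: coord_objective_def)
qed

text \<open>
  The tube of coordinate \<open>i\<close>, with times starting at 1.
\<close>

definition lower :: "(nat \<Rightarrow> nat \<Rightarrow> real) \<Rightarrow> (nat \<Rightarrow> real) \<Rightarrow> nat \<Rightarrow> nat \<Rightarrow> real" where
  "lower m lam i r = m (r - 1) i - lam (r - 1)"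

definition upper :: "(nat \<Rightarrow> nat \<Rightarrow> real) \<Rightarrow> (nat \<Rightarrow> real) \<Rightarrow> nat \<Rightarrow> nat \<Rightarrow> real" where
  "upper m lam i r = m (r - 1) i + lam (r - 1)"

lemma in_tube_iff:
  assumes "tube q (Suc T)"
  shows "tube.in_tube (Suc T) (lower m lam i) (upper m lam i) (\<lambda>r. x (r - 1)) \<longleftrightarrow>
    (\<forall>t\<le>T. \<bar>x t - m t i\<bar> \<le> lam t)"
proof -
  interpret tube q "Suc T" "lower m lam i" "upper m lam i"
    by (rule assms)
  have "in_tube (\<lambda>r. x (r - 1)) \<longleftrightarrow> (\<forall>r\<in>{1..Suc T}. \<bar>x (r - 1) - m (r - 1) i\<bar> \<le> lam (r - 1))"
    by (auto simp: in_tube_def lower_def upper_def abs_le_iff)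
  also have "\<dots> \<longleftrightarrow> (\<forall>t\<le>T. \<bar>x t - m t i\<bar> \<le> lam t)"
    by (auto simp: Ball_def dest: spec[of _ "Suc _"])
  finally show ?thesis .
qed

text \<open>
  Both weights \<open>\<gamma>\<close> and \<open>1 - \<gamma>\<close> are nonnegative, so a sequence that dominates
  another one has the smaller objective. Hence a minimizer over the list of each coordinate
  is a minimizer over all feasible sequences, and the sum over the coordinates is minimal.
\<close>

lemma solution_path_if_coords_ok:
  assumes q: "q = 0 \<or> 1 \<le> q" and p: "1 \<le> p"
    and ok: "\<And>i. i \<in> {1..p} \<Longrightarrow> tube.coord_ok q (Suc T) (lower m lam i) (upper m lam i) s i"
  shows "solution_path q p T m lam (computed_path s)"
proof -
  have tube: "tube q (Suc T)"
    by (rule tube.intro) (use q in auto)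
  let ?th = "\<lambda>i k t. reals s (''theta'', [i, k, t])"
  note coord_ok = ok[unfolded tube.coord_ok_def[OF tube]]
  have path: "set (computed_path s i) = ?th i ` {..Suc T}" if "i \<in> {1..p}" for i
  proof -
    have "nats s (''count'', [i]) = Suc (Suc T)"
      using coord_ok[OF that] by simp
    then show ?thesis
      unfolding computed_path_def set_map set_upt atLeast0LessThan by (simp only: lessThan_Suc_atMost)
  qed
  have feas: "\<forall>t\<le>T. \<bar>?th i k t - m t i\<bar> \<le> lam t" if "i \<in> {1..p}" "k \<le> Suc T" for i k
    using coord_ok[OF that(1)] that(2)
    by (intro iffD1[OF in_tube_iff[OF tube, where m = m and lam = lam and i = i and x = "?th i k"]]) simp
  have best: "\<exists>k\<le>Suc T.
        tube.supp (\<lambda>r. ?th i k (r - 1)) 0 (Suc T) \<le> tube.supp (\<lambda>r. x (r - 1)) 0 (Suc T) \<and>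
        tube.var q (\<lambda>r. ?th i k (r - 1)) 1 (Suc T) \<le> tube.var q (\<lambda>r. x (r - 1)) 1 (Suc T)"
    if "i \<in> {1..p}" "\<forall>t\<le>T. \<bar>x t - m t i\<bar> \<le> lam t" for i x
    using conjunct2[OF conjunct2[OF coord_ok[OF that(1)]], rule_format,
        OF iffD2[OF in_tube_iff[OF tube, where m = m and lam = lam and i = i and x = x] that(2)]] .
  have dominated: "\<exists>y\<in>set (computed_path s i). coord_objective q T \<gamma> y \<le> coord_objective q T \<gamma> x"
    if i: "i \<in> {1..p}" and \<gamma>: "\<gamma> \<in> {0..1}" and x: "\<forall>t\<le>T. \<bar>x t - m t i\<bar> \<le> lam t" for i \<gamma> x
  proof -
    obtain k where k: "k \<le> Suc T"
      "tube.supp (\<lambda>r. ?th i k (r - 1)) 0 (Suc T) \<le> tube.supp (\<lambda>r. x (r - 1)) 0 (Suc T)"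
      "tube.var q (\<lambda>r. ?th i k (r - 1)) 1 (Suc T) \<le> tube.var q (\<lambda>r. x (r - 1)) 1 (Suc T)"
      using best[OF i x] by blast
    then have "coord_objective q T \<gamma> (?th i k) \<le> coord_objective q T \<gamma> x"
      unfolding coord_objective_eq[OF tube] using \<gamma> by (intro add_mono mult_left_mono) auto
    moreover have "?th i k \<in> set (computed_path s i)"
      using path[OF i] k(1) by auto
    ultimately show ?thesis
      by blast
  qed
  show ?thesis
    unfolding solution_path_def
  proof (intro conjI ballI allI impI)
    fix i assume i: "i \<in> {1..p}"
    show "computed_path s i \<noteq> []"
      using path[OF i] by (cases "computed_path s i") auto
    fix x t assume "x \<in> set (computed_path s i)" "t \<le> T"
    then show "\<bar>x t - m t i\<bar> \<le> lam t"
      using path[OF i] feas[OF i] by auto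
  next
    fix \<gamma> :: real and x
    assume \<gamma>: "\<gamma> \<in> {0..1}"
      and x: "\<forall>i\<in>{1..p}. x i \<in> set (computed_path s i) \<and>
        (\<forall>y\<in>set (computed_path s i). coord_objective q T \<gamma> (x i) \<le> coord_objective q T \<gamma> y)"
    have "\<bar>x i t - m t i\<bar> \<le> lam t" if i: "i \<in> {1..p}" and "t \<le> T" for i t
    proof -
      have "x i \<in> set (computed_path s i)"
        using x i by blast
      then show ?thesis
        using path[OF i] feas[OF i] \<open>t \<le> T\<close> by auto
    qed
    then have "feasible p T m lam (\<lambda>t i. x i t)"
      unfolding feasible_iff[OF p] by blast
    moreover have "objective q p T \<gamma> (\<lambda>t i. x i t) \<le> objective q p T \<gamma> \<theta>"
      if "feasible p T m lam \<theta>" for \<theta>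
      unfolding objective_eq_sum
    proof (rule sum_mono)
      fix i assume i: "i \<in> {1..p}"
      then have "\<forall>t\<le>T. \<bar>\<theta> t i - m t i\<bar> \<le> lam t"
        using that unfolding feasible_iff[OF p] by blast
      then obtain y where "y \<in> set (computed_path s i)"
        "coord_objective q T \<gamma> y \<le> coord_objective q T \<gamma> (\<lambda>t. \<theta> t i)"
        using dominated[OF i \<gamma>, of "\<lambda>t. \<theta> t i"] by blast
      then show "coord_objective q T \<gamma> (\<lambda>t. x i t) \<le> coord_objective q T \<gamma> (\<lambda>t. \<theta> t i)"
        using x i by force
    qed
    ultimately show "optimal q p T m lam \<gamma> (\<lambda>t i. x i t)"
      unfolding optimal_def by blast
  qed
qed

lemma path_com_correct:
  assumes q: "q = 0 \<or> 1 \<le> q" and p: "1 \<le> p" and T: "1 \<le> T" and lam: "\<forall>t\<le>T. 0 \<le> lam t"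
  shows "runs q (path_com q) (input_store p T m lam) (15000 * (p * Suc T ^ 3))
    (\<lambda>s. solution_path q p T m lam (computed_path s))"
  unfolding path_com_def
proof (rule runs_Sequ)
  let ?n = "Suc T" and ?W = "{''n'', ''M''}"
  let ?s = "input_store p T m lam"
  have tube: "tube q ?n"
    by (rule tube.intro) (use q in auto)
  show "runs q (NAssign ''n'' [] (NAdd (NV ''T'') (NConst 1)) ;;
      NAssign ''M'' [] (NAdd (thrice (NV ''n'')) (NConst 1))) ?s 20
    (\<lambda>s. same_outside ?W ?s s \<and> nats s (''n'', []) = ?n \<and> nats s (''M'', []) = 3 * ?n + 1)"
    by (simp add: same_outside_def input_store_def)
  fix s
  assume "same_outside ?W ?s s \<and> nats s (''n'', []) = ?n \<and> nats s (''M'', []) = 3 * ?n + 1"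
  then have so: "same_outside ?W ?s s" and nM: "nats s (''n'', []) = ?n" "nats s (''M'', []) = 3 * ?n + 1"
    by auto
  define a where "a i t = reals ?s (''m'', [t - 1, i]) - reals ?s (''lambda'', [t - 1])" for i t :: nat
  define b where "b i t = reals ?s (''m'', [t - 1, i]) + reals ?s (''lambda'', [t - 1])" for i t :: nat
  have ab: "a i r = lower m lam i r" "b i r = upper m lam i r" if "i \<in> {1..p}" "r \<in> {1..?n}" for i r
    using that by (auto simp: a_def b_def lower_def upper_def input_store_def)
  let ?ok = "\<lambda>s i. tube.coord_ok q ?n (a i) (b i) s i"
  show "runs q (For ''i'' (NConst 1) (NAdd (NV ''p'') (NConst 1)) (coord_com q)) s (14020 * (p * ?n ^ 3))
      (\<lambda>s. solution_path q p T m lam (computed_path s))"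
  proof (rule runs_For[where L = 1 and H = "p + 1" and B = "14000 * ?n ^ 3" and
      I = "\<lambda>l s. \<forall>i\<in>{1..<l}. ?ok s i"])
    fix i s'
    assume i: "1 \<le> i" "i < p + 1" "nats s' (''i'', []) = i"
      and so': "same_outside (insert ''i'' (writes (coord_com q))) s s'" and I: "\<forall>j\<in>{1..<i}. ?ok s' j"
    interpret tube q ?n "a i" "b i"
      by (rule tube)
    have inp: "reals s' (''m'', is) = reals ?s (''m'', is)" "reals s' (''lambda'', is) = reals ?s (''lambda'', is)" for "is"
      using so so' by (simp_all add: same_outside_def)
    have "0 \<le> lam (r - 1)" if "r \<in> {1..?n}" for r
      using that lam by auto
    then have m: "in_tube (\<lambda>r. reals s' (''m'', [r - 1, i]))"
      using i by (auto simp: in_tube_def inp a_def b_def input_store_def)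
    have "runs q (coord_com q) s' (14000 * ?n ^ 3)
        (\<lambda>s''. coord_ok s'' i \<and> (\<forall>i'. i' \<noteq> i \<longrightarrow> same_output s' s'' i'))"
    proof (rule coord_com_correct)
      show "nats s' (''n'', []) = ?n" "nats s' (''M'', []) = 3 * ?n + 1"
        using so' nM by (simp_all add: same_outside_def)
    qed (use i m in \<open>simp_all add: a_def b_def inp\<close>)
    then show "runs q (coord_com q) s' (14000 * ?n ^ 3) (\<lambda>s''. same_outside (writes (coord_com q)) s' s'' \<longrightarrow>
        (\<forall>j\<in>{1..<Suc i}. ?ok (set_nat s'' ''i'' (Suc i)) j))"
    proof (rule runs_mono[OF _ order_refl], intro impI ballI)
      fix s'' j
      assume s'': "coord_ok s'' i \<and> (\<forall>i'. i' \<noteq> i \<longrightarrow> same_output s' s'' i')" and j: "j \<in> {1..<Suc i}"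
      interpret j: tube q ?n "a j" "b j"
        by (rule tube)
      have "j.coord_ok s'' j"
        using s'' j I j.coord_ok_same[of s' j s''] by (cases "j = i") (auto simp: less_Suc_eq)
      then show "j.coord_ok (set_nat s'' ''i'' (Suc i)) j"
        by (simp add: j.coord_ok_def)
    qed
  next
    fix s'
    assume "\<forall>i\<in>{1..<p + 1}. ?ok s' i"
    moreover have "tube.coord_ok q ?n (lower m lam i) (upper m lam i) s' i" if "?ok s' i" "i \<in> {1..p}" for i
    proof -
      have "tube.in_tube ?n (a i) (b i) x \<longleftrightarrow> tube.in_tube ?n (lower m lam i) (upper m lam i) x" for x
        using ab[OF that(2)] by (simp add: tube.in_tube_def[OF tube])
      then show ?thesis
        using that(1) by (simp add: tube.coord_ok_def[OF tube])
    qed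
    ultimately show "solution_path q p T m lam (computed_path s')"
      by (intro solution_path_if_coords_ok[OF q p]) auto
  next
    show "nval s' (NAdd (NV ''p'') (NConst 1)) = p + 1"
      if "same_outside (insert ''i'' (writes (coord_com q))) s s'" for s'
      using that so by (simp add: same_outside_def input_store_def)
    have "1 \<le> ?n ^ 3"
      by simp
    then have "14000 * ?n ^ 3 + 9 \<le> 14009 * ?n ^ 3"
      by linarith
    then have "p * (14000 * ?n ^ 3 + 9) \<le> p * (14009 * ?n ^ 3)"
      by (rule mult_le_mono2)
    also have "\<dots> = 14009 * (p * ?n ^ 3)"
      by (rule mult.left_commute)
    finally have "p * (14000 * ?n ^ 3 + 9) \<le> 14009 * (p * ?n ^ 3)" .
    moreover have "1 \<le> p * ?n ^ 3"
      using p by simp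
    ultimately have "p * (14000 * ?n ^ 3 + 9) + 7 \<le> 14020 * (p * ?n ^ 3)"
      by linarith
    then show "(p + 1 - 1) * (14000 * ?n ^ 3 + ncost (NAdd (NV ''p'') (NConst 1)) + 6) + ncost (NConst 1) +
        ncost (NAdd (NV ''p'') (NConst 1)) + 3 \<le> 14020 * (p * ?n ^ 3)"
      by (simp add: ac_simps)
  qed auto
next
  have "1 \<le> p * Suc T ^ 3"
    using p by simp
  then show "20 + 14020 * (p * Suc T ^ 3) \<le> 15000 * (p * Suc T ^ 3)"
    by linarith
qed

theorem theorem1:
  fixes q :: real
  assumes "q = 0 \<or> 1 \<le> q"
  shows "\<exists>(prog :: com) (C :: nat).
    \<forall>(p :: nat) (T :: nat) (m :: nat \<Rightarrow> nat \<Rightarrow> real) (lam :: nat \<Rightarrow> real).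
      1 \<le> p \<and> 1 \<le> T \<and> (\<forall>t\<le>T. 0 \<le> lam t) \<longrightarrow>
      (\<exists>n s. exec q prog (input_store p T m lam) n s \<and>
             n \<le> C * (p * T ^ 3) \<and>
             solution_path q p T m lam (computed_path s))"
proof (rule exI[of _ "path_com q"], rule exI[of _ 120000], intro allI impI)
  fix p T :: nat and m :: "nat \<Rightarrow> nat \<Rightarrow> real" and lam :: "nat \<Rightarrow> real"
  assume *: "1 \<le> p \<and> 1 \<le> T \<and> (\<forall>t\<le>T. 0 \<le> lam t)"
  then have "Suc T ^ 3 \<le> (2 * T) ^ 3"
    by (intro power_mono) auto
  then have "15000 * (p * Suc T ^ 3) \<le> 15000 * (p * (2 * T) ^ 3)"
    by (intro mult_le_mono2)
  then have "15000 * (p * Suc T ^ 3) \<le> 120000 * (p * T ^ 3)"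
    by (simp add: power_mult_distrib)
  then have "runs q (path_com q) (input_store p T m lam) (120000 * (p * T ^ 3))
      (\<lambda>s. solution_path q p T m lam (computed_path s))"
    using * by (intro runs_mono[OF path_com_correct[OF assms]]) auto
  then show "\<exists>n s. exec q (path_com q) (input_store p T m lam) n s \<and>
      n \<le> 120000 * (p * T ^ 3) \<and> solution_path q p T m lam (computed_path s)"
    by (simp add: wp_def)
qed

end
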